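(* Let $n\ge3$. Then: (1) $KB_n=\ker\pi_K$ contains no non-trivial abelian normal subgroup of $VB_n$; (2) $PVT_n=\ker\sigma$ contains no non-trivial abelian normal subgroup of $VT_n$; (3) $KT_n=\ker\theta$ contains no non-trivial abelian normal subgroup of $VT_n$.
   Context: The virtual braid group $VB_n$ has generators $\sigma_1,\dots,\sigma_{n-1},v_1,\dots,v_{n-1}$ and relations: $\sigma_i\sigma_{i+1}\sigma_i=\sigma_{i+1}\sigma_i\sigma_{i+1}$, $\sigma_i\sigma_j=\sigma_j\sigma_i$ ($|i-j|\ge2$); $v_i^2=1$, $v_iv_{i+1}v_i=v_{i+1}v_iv_{i+1}$, $v_iv_j=v_jv_i$ ($|i-j|\ge2$); $\sigma_iv_j=v_j\sigma_i$ ($|i-j|\ge2$), $v_iv_{i+1}\sigma_i=\sigma_{i+1}v_iv_{i+1}$. The epimorphism $\pi_K\colon VB_n\to S_n$ is given by $\pi_K(\sigma_i)=1$, $\pi_K(v_i)=(i,i+1)$. The virtual twin group $VT_n$ has generators $s_1,\dots,s_{n-1},\rho_1,\dots,\rho_{n-1}$ and relations: $s_i^2=1$, $s_is_j=s_js_i$ ($|i-j|\ge2$); $\rho_i^2=1$, $\rho_i\rho_j=\rho_j\rho_i$ ($|i-j|\ge2$), $\rho_i\rho_{i+1}\rho_i=\rho_{i+1}\rho_i\rho_{i+1}$; $\rho_is_j=s_j\rho_i$ ($|i-j|\ge2$), $\rho_i\rho_{i+1}s_i=s_{i+1}\rho_i\rho_{i+1}$. The epimorphisms $\sigma,\theta\colon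 VT_n\to S_n$ are given by $\sigma(s_i)=\sigma(\rho_i)=(i,i+1)$ and $\theta(s_i)=1$, $\theta(\rho_i)=(i,i+1)$. *)

theory Defs
  imports "HOL-Algebra.Algebra" "HOL-Combinatorics.Transposition"
begin

text \<open>A word is a list of letters (x, True) = x and (x, False) = x^-1.\<close>
type_synonym 'a word = "('a \<times> bool) list"

definition winv :: "'a word \<Rightarrow> 'a word" where
  "winv w = rev (map (\<lambda>(x, b). (x, \<not> b)) w)"

definition pw :: "'a list \<Rightarrow> 'a word" where
  "pw xs = map (\<lambda>x. (x, True)) xs"

definition relator :: "'a list \<Rightarrow> 'a list \<Rightarrow> 'a word" where
  "relator u w = pw u @ winv (pw w)"

inductive wequiv :: "'a word set \<Rightarrow> 'a word \<Rightarrow> 'a word \<Rightarrow> bool" for R where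
  wrefl: "wequiv R w w"
| wsym: "wequiv R u w \<Longrightarrow> wequiv R w u"
| wtrans: "wequiv R u v \<Longrightarrow> wequiv R v w \<Longrightarrow> wequiv R u w"
| wcancel: "wequiv R (u @ [(x, b), (x, \<not> b)] @ v) (u @ v)"
| wrel: "r \<in> R \<Longrightarrow> wequiv R (u @ r @ v) (u @ v)"

definition wclass :: "'a word set \<Rightarrow> 'a word \<Rightarrow> 'a word set" where
  "wclass R w = {v. wequiv R w v}"

definition presented_group :: "'a set \<Rightarrow> 'a word set \<Rightarrow> 'a word set monoid" where
  "presented_group Xs Rs =
     \<lparr> carrier = {wclass Rs w | w. w \<in> lists (Sigma Xs (\<lambda>_. UNIV))},
       monoid.mult = (\<lambda>A B. {w. \<exists>a\<in>A. \<exists>b\<in>B. wequiv Rs (a @ b) w}),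
       monoid.one = wclass Rs [] \<rparr>"

definition weval :: "('a \<Rightarrow> nat \<Rightarrow> nat) \<Rightarrow> 'a word \<Rightarrow> nat \<Rightarrow> nat" where
  "weval f w = foldr (\<lambda>(x, b) acc. (if b then f x else Hilbert_Choice.inv (f x)) \<circ> acc) w id"

definition pkernel :: "'a set \<Rightarrow> 'a word set \<Rightarrow> ('a \<Rightarrow> nat \<Rightarrow> nat) \<Rightarrow> 'a word set set" where
  "pkernel Xs Rs f = {A \<in> carrier (presented_group Xs Rs). \<exists>w\<in>A. weval f w = id}"

datatype vbgen = Sig nat | Vg nat

definition VB_gens :: "nat \<Rightarrow> vbgen set" where
  "VB_gens n = {Sig i | i. 1 \<le> i \<and> i \<le> n - 1} \<union> {Vg i | i. 1 \<le> i \<and> i \<le> n - 1}"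

definition far :: "nat \<Rightarrow> nat \<Rightarrow> bool" where
  "far i j \<longleftrightarrow> i + 2 \<le> j \<or> j + 2 \<le> i"

definition VB_rels :: "nat \<Rightarrow> vbgen word set" where
  "VB_rels n =
     {relator [Sig i, Sig (i+1), Sig i] [Sig (i+1), Sig i, Sig (i+1)] | i. 1 \<le> i \<and> i + 1 \<le> n - 1}
   \<union> {relator [Sig i, Sig j] [Sig j, Sig i] | i j. 1 \<le> i \<and> i \<le> n - 1 \<and> 1 \<le> j \<and> j \<le> n - 1 \<and> far i j}
   \<union> {relator [Vg i, Vg i] [] | i. 1 \<le> i \<and> i \<le> n - 1}
   \<union> {relator [Vg i, Vg (i+1), Vg i] [Vg (i+1), Vg i, Vg (i+1)] | i. 1 \<le> i \<and> i + 1 \<le> n - 1}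
   \<union> {relator [Vg i, Vg j] [Vg j, Vg i] | i j. 1 \<le> i \<and> i \<le> n - 1 \<and> 1 \<le> j \<and> j \<le> n - 1 \<and> far i j}
   \<union> {relator [Sig i, Vg j] [Vg j, Sig i] | i j. 1 \<le> i \<and> i \<le> n - 1 \<and> 1 \<le> j \<and> j \<le> n - 1 \<and> far i j}
   \<union> {relator [Vg i, Vg (i+1), Sig i] [Sig (i+1), Vg i, Vg (i+1)] | i. 1 \<le> i \<and> i + 1 \<le> n - 1}"

definition VB :: "nat \<Rightarrow> vbgen word set monoid" where
  "VB n = presented_group (VB_gens n) (VB_rels n)"

fun piK_gen :: "vbgen \<Rightarrow> nat \<Rightarrow> nat" where
  "piK_gen (Sig i) = id"
| "piK_gen (Vg i) = Transposition.transpose i (i+1)"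

definition KB :: "nat \<Rightarrow> vbgen word set set" where
  "KB n = pkernel (VB_gens n) (VB_rels n) piK_gen"

datatype vtgen = Tw nat | Rho nat

definition VT_gens :: "nat \<Rightarrow> vtgen set" where
  "VT_gens n = {Tw i | i. 1 \<le> i \<and> i \<le> n - 1} \<union> {Rho i | i. 1 \<le> i \<and> i \<le> n - 1}"

definition VT_rels :: "nat \<Rightarrow> vtgen word set" where
  "VT_rels n =
     {relator [Tw i, Tw i] [] | i. 1 \<le> i \<and> i \<le> n - 1}
   \<union> {relator [Tw i, Tw j] [Tw j, Tw i] | i j. 1 \<le> i \<and> i \<le> n - 1 \<and> 1 \<le> j \<and> j \<le> n - 1 \<and> far i j}
   \<union> {relator [Rho i, Rho i] [] | i. 1 \<le> i \<and> i \<le> n - 1}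
   \<union> {relator [Rho i, Rho j] [Rho j, Rho i] | i j. 1 \<le> i \<and> i \<le> n - 1 \<and> 1 \<le> j \<and> j \<le> n - 1 \<and> far i j}
   \<union> {relator [Rho i, Rho (i+1), Rho i] [Rho (i+1), Rho i, Rho (i+1)] | i. 1 \<le> i \<and> i + 1 \<le> n - 1}
   \<union> {relator [Rho i, Tw j] [Tw j, Rho i] | i j. 1 \<le> i \<and> i \<le> n - 1 \<and> 1 \<le> j \<and> j \<le> n - 1 \<and> far i j}
   \<union> {relator [Rho i, Rho (i+1), Tw i] [Tw (i+1), Rho i, Rho (i+1)] | i. 1 \<le> i \<and> i + 1 \<le> n - 1}"

definition VT :: "nat \<Rightarrow> vtgen word set monoid" where
  "VT n = presented_group (VT_gens n) (VT_rels n)"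

fun sigma_gen :: "vtgen \<Rightarrow> nat \<Rightarrow> nat" where
  "sigma_gen (Tw i) = Transposition.transpose i (i+1)"
| "sigma_gen (Rho i) = Transposition.transpose i (i+1)"

fun theta_gen :: "vtgen \<Rightarrow> nat \<Rightarrow> nat" where
  "theta_gen (Tw i) = id"
| "theta_gen (Rho i) = Transposition.transpose i (i+1)"

definition PVT :: "nat \<Rightarrow> vtgen word set set" where
  "PVT n = pkernel (VT_gens n) (VT_rels n) sigma_gen"

definition KT :: "nat \<Rightarrow> vtgen word set set" where
  "KT n = pkernel (VT_gens n) (VT_rels n) theta_gen"

definition abelian_normal_in :: "('g, 'b) monoid_scheme \<Rightarrow> 'g set \<Rightarrow> 'g set \<Rightarrow> bool" where
  "abelian_normal_in G K H \<longleftrightarrow> H \<lhd> G \<and> H \<subseteq> K \<and>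
     (\<forall>x\<in>H. \<forall>y\<in>H. x \<otimes>\<^bsub>G\<^esub> y = y \<otimes>\<^bsub>G\<^esub> x)"

end

theory Submission
  imports Defs "HOL-Library.Z2"
begin

text \<open>
Both groups are semidirect products of the symmetric group with a group generated by arcs
\<open>x\<^sub>i\<^sub>j\<close> (\<open>i \<noteq> j\<close>): disjoint arcs commute, and for \<open>VB\<close> consecutive arcs satisfy the braid
relation (an Artin group), while for \<open>VT\<close> the arcs are involutions (a right-angled Coxeter group).

Let \<open>A\<close> be such a group with generating set \<open>S\<close>. If \<open>s\<close> and \<open>t\<close> satisfy no relation, then \<open>A\<close> is the
amalgamated product of the subgroups generated by \<open>S - {t}\<close> and \<open>S - {s}\<close>, and an abelian normal
subgroup lies in the amalgamated one, generated by \<open>S - {s, t}\<close>. Standard parabolic subgroups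
intersect in standard parabolic subgroups: read a word while walking through the minimal coset
representatives of the Coxeter group, and record a letter whenever the walk stays in place; this is
a well-defined set retraction onto the parabolic subgroup (Charney and Paris). As every arc belongs
to a pair without relation, the abelian normal subgroup is trivial.

For \<open>PVT\<close>, an abelian normal subgroup of \<open>VT\<close> meets \<open>KT\<close> trivially, hence centralises it, and then
the abelianisation of \<open>KT\<close> shows that it lies in \<open>KT\<close>.
\<close>

section \<open>Words and presented groups\<close>

text \<open>The recurring obstacle is well-definedness: the geometric representation, the signs of
  reflections, the retraction, the normal forms and the semidirect product must depend on group
  elements, not on words. Each is therefore given as one permutation per generator and checked on
  the relators only.

  The walk runs through the Coxeter group of the matrix even when the group at hand is the Artin
  group, because inversions live there; only the recorded letters belong to the Artin group.

  Abelian normal subgroups are confined to the amalgamated subgroup by comparing lengths of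
  alternating products. A shortest product of even length needs a conjugator that avoids several
  cosets of the amalgamated subgroup, and a third arc unrelated to the given one supplies it; this
  is where n \<ge> 3 enters. The pair without relation consists of an arc (i, j) and its opposite
  (j, i).\<close>

typedef 'b symgrp = "{f :: 'b \<Rightarrow> 'b. bij f}"
  morphisms app Sym
  using bij_id by blast

lemma bij_app: "bij (app p)"
  using app by auto

lemma app_Sym: "bij f \<Longrightarrow> app (Sym f) = f"
  by (simp add: Sym_inverse)

lemma symgrp_eqI: "(\<And>z. app p z = app q z) \<Longrightarrow> p = q"
  by (metis app_inject ext)

text \<open>The symmetric group is written additively, because \<open>group_add\<close> is the only type class
  of noncommutative groups; \<open>p + q\<close> means first \<open>p\<close>, then \<open>q\<close>, so that it acts from the right.\<close>

instantiation symgrp :: (type) group_add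
begin
definition zero_symgrp :: "'a symgrp" where "0 = Sym id"
definition plus_symgrp :: "'a symgrp \<Rightarrow> 'a symgrp \<Rightarrow> 'a symgrp"
  where "p + q = Sym (app q \<circ> app p)"
definition uminus_symgrp :: "'a symgrp \<Rightarrow> 'a symgrp"
  where "- p = Sym (Hilbert_Choice.inv (app p))"
definition minus_symgrp :: "'a symgrp \<Rightarrow> 'a symgrp \<Rightarrow> 'a symgrp"
  where "p - q = p + - (q :: 'a symgrp)"

lemma app_zero [simp]: "app 0 z = z"
  by (simp add: zero_symgrp_def app_Sym)

lemma app_plus [simp]: "app (p + q) z = app q (app p z)"
  by (simp add: plus_symgrp_def app_Sym bij_app bij_comp)

lemma app_uminus: "app (- p) = Hilbert_Choice.inv (app p)"
  by (simp add: uminus_symgrp_def app_Sym bij_app bij_imp_bij_inv)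

instance
  by standard
    (auto intro!: symgrp_eqI simp: app_uminus minus_symgrp_def bij_app bij_is_surj surj_f_inv_f)
end

lemma involution_app:
  assumes "\<And>z. f (f z) = z"
  shows "app (Sym f) = f" and "Sym f + Sym f = 0"
proof -
  have "bij f" using assms by (metis involuntory_imp_bij)
  then show "app (Sym f) = f" by (rule app_Sym)
  then show "Sym f + Sym f = 0" using assms by (intro symgrp_eqI) simp
qed

lemmas gsimps = diff_conv_add_uminus add.assoc minus_add

section \<open>Values of words in a group\<close>

definition ev :: "('a \<Rightarrow> 'g::group_add) \<Rightarrow> 'a word \<Rightarrow> 'g" where
  "ev f w = sum_list (map (\<lambda>(x, b). if b then f x else - f x) w)"

lemma ev_simps [simp]:
  "ev f [] = 0"
  "ev f ((x, b) # w) = (if b then f x else - f x) + ev f w"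
  by (simp_all add: ev_def)

lemma ev_append [simp]: "ev f (u @ v) = ev f u + ev f v"
  by (simp add: ev_def)

lemma winv_simps [simp]:
  "winv [] = []"
  "winv ((x, b) # w) = winv w @ [(x, \<not> b)]"
  by (simp_all add: winv_def)

lemma winv_lists [simp]: "winv w \<in> lists (Sigma S (\<lambda>_. UNIV)) \<longleftrightarrow> w \<in> lists (Sigma S (\<lambda>_. UNIV))"
  by (induction w) auto

lemma ev_winv [simp]: "ev f (winv w) = - ev f w"
  by (induction w) (auto simp: minus_add)

lemma ev_relator: "ev f (relator u v) = sum_list (map f u) - sum_list (map f v)"
proof -
  have "ev f (pw xs) = sum_list (map f xs)" for xs
    by (induction xs) (auto simp: pw_def)
  then show ?thesis by (simp add: relator_def)
qed

lemma wequiv_ev: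
  assumes "wequiv R u v" "\<And>r. r \<in> R \<Longrightarrow> ev f r = 0"
  shows "ev f u = ev f v"
  using assms by (induction rule: wequiv.induct) auto

lemma wequiv_cong1: "wequiv R u v \<Longrightarrow> wequiv R (a @ u @ b) (a @ v @ b)"
proof (induction rule: wequiv.induct)
  case (wcancel u x c v)
  then show ?case using wequiv.wcancel[of R "a @ u" x c "v @ b"] by simp
next
  case (wrel r u v)
  then show ?case using wequiv.wrel[of r R "a @ u" "v @ b"] by simp
qed (auto intro: wequiv.intros)

lemma wequiv_append: "wequiv R u u' \<Longrightarrow> wequiv R v v' \<Longrightarrow> wequiv R (u @ v) (u' @ v')"
  using wequiv_cong1[of R u u' "[]" v] wequiv_cong1[of R v v' u' "[]"] wtrans by fastforce

lemma wequiv_winv: "wequiv R (winv w @ w) []"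
proof (induction w)
  case (Cons l w)
  obtain x b where l: "l = (x, b)" by force
  have "wequiv R (winv w @ [(x, \<not> b), (x, \<not> \<not> b)] @ w) (winv w @ w)" by (rule wcancel)
  then show ?case using Cons wtrans unfolding l by fastforce
qed (simp add: wrefl)

lemma wclass_eq_iff: "wclass R u = wclass R v \<longleftrightarrow> wequiv R u v"
  unfolding wclass_def by (blast intro: wrefl wsym wtrans)

text \<open>The right regular representation of the group presented by \<open>R\<close>.\<close>

definition canon_step :: "'a word set \<Rightarrow> 'a \<times> bool \<Rightarrow> 'a word set \<Rightarrow> 'a word set" where
  "canon_step R l A = (if \<exists>w. A = wclass R w then wclass R ((SOME w. A = wclass R w) @ [l]) else A)"

definition canon :: "'a word set \<Rightarrow> 'a \<Rightarrow> 'a word set symgrp" where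
  "canon R x = Sym (canon_step R (x, True))"

lemma canon_step_wclass: "canon_step R l (wclass R w) = wclass R (w @ [l])"
proof -
  have "wclass R w = wclass R (SOME v. wclass R w = wclass R v)"
    by (rule someI[of "\<lambda>v. wclass R w = wclass R v" w]) simp
  then show ?thesis
    unfolding canon_step_def by (auto simp: wclass_eq_iff intro!: wequiv_append intro: wrefl wsym)
qed

lemma canon_step_inverse: "canon_step R (x, \<not> b) (canon_step R (x, b) A) = A"
proof (cases "\<exists>w. A = wclass R w")
  case True
  then obtain w where A: "A = wclass R w" by blast
  have "wequiv R (w @ [(x, b), (x, \<not> b)] @ []) (w @ [])" by (rule wcancel)
  then show ?thesis by (simp add: A canon_step_wclass wclass_eq_iff)
qed (auto simp: canon_step_def)

lemma app_canon: "app (if b then canon R x else - canon R x) = canon_step R (x, b)"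
proof -
  have inv: "canon_step R (x, c) (canon_step R (x, \<not> c) A) = A" for c A
    using canon_step_inverse[of R x "\<not> c" A] by simp
  have "bij (canon_step R (x, True))"
    using inv[of True] inv[of False] by (intro o_bij[of "canon_step R (x, False)"]) auto
  then have 1: "app (canon R x) = canon_step R (x, True)" by (simp add: canon_def app_Sym)
  moreover have "app (- canon R x) = canon_step R (x, False)"
    unfolding app_uminus 1 using inv[of True] inv[of False]
    by (intro inv_equality) auto
  ultimately show ?thesis by simp
qed

lemma app_ev_canon: "app (ev (canon R) w) (wclass R u) = wclass R (u @ w)"
  by (induction w arbitrary: u) (auto simp: app_canon canon_step_wclass)

text \<open>A word carries the class of the empty word to its own class, so equal permutations force
  equivalent words. Conversely a relator fixes every class, and sets that are not classes are fixed
  letter by letter, so it acts as 0 on the whole type.\<close>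

lemma ev_canon_eq_iff: "ev (canon R) u = ev (canon R) v \<longleftrightarrow> wequiv R u v"
proof
  assume "ev (canon R) u = ev (canon R) v"
  then show "wequiv R u v"
    using app_ev_canon[of R u "[]"] app_ev_canon[of R v "[]"] by (simp flip: wclass_eq_iff)
next
  have "ev (canon R) r = 0" if "r \<in> R" for r
  proof (rule symgrp_eqI)
    fix A
    show "app (ev (canon R) r) A = app 0 A"
    proof (cases "\<exists>w. A = wclass R w")
      case True
      then obtain w where "A = wclass R w" by blast
      then show ?thesis
        using wrel[OF that, of w "[]"] by (simp add: app_ev_canon wclass_eq_iff)
    next
      case False
      then have "app (ev (canon R) w) A = A" for w
        by (induction w) (auto simp: app_canon canon_step_def simp del: if_split)
      then show ?thesis by simp
    qed
  qed
  then show "wequiv R u v \<Longrightarrow> ev (canon R) u = ev (canon R) v" using wequiv_ev by blast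
qed

lemma canon_rel: "r \<in> R \<Longrightarrow> ev (canon R) r = 0"
  using ev_canon_eq_iff[of R r "[]"] wrel[of r R "[]" "[]"] by simp

text \<open>This makes a construction on words independent of the word: to let the presented group
  act it suffices to give one permutation per generator and test the relators.\<close>

lemma ev_canon_universal:
  assumes "\<And>r. r \<in> R \<Longrightarrow> ev f r = 0" "ev (canon R) u = ev (canon R) v"
  shows "ev f u = ev f v"
  using assms wequiv_ev by (metis ev_canon_eq_iff)

section \<open>Subgroups generated by a set of letters\<close>

definition gspan :: "('a \<Rightarrow> 'g::group_add) \<Rightarrow> 'a set \<Rightarrow> 'g set" where
  "gspan f S = ev f ` lists (Sigma S (\<lambda>_. UNIV))"

lemma gspan_zero: "0 \<in> gspan f S"
  unfolding gspan_def by (intro image_eqI[of _ _ "[]"]) auto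

lemma gspan_gen: "s \<in> S \<Longrightarrow> f s \<in> gspan f S"
  unfolding gspan_def by (intro image_eqI[of _ _ "[(s, True)]"]) auto

lemma gspan_add: "a \<in> gspan f S \<Longrightarrow> b \<in> gspan f S \<Longrightarrow> a + b \<in> gspan f S"
  unfolding gspan_def by (elim imageE) (simp flip: ev_append del: in_lists_conv_set add: append_in_lists_conv imageI)

lemma gspan_uminus: "a \<in> gspan f S \<Longrightarrow> - a \<in> gspan f S"
  unfolding gspan_def by (elim imageE) (simp flip: ev_winv del: in_lists_conv_set add: imageI)

lemma gspan_mono: "S \<subseteq> T \<Longrightarrow> gspan f S \<subseteq> gspan f T"
  unfolding gspan_def by (intro image_mono lists_mono) auto

lemma gspan_empty: "gspan f {} = {0}"
  by (auto simp: gspan_def)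

section \<open>Groups with commutation and braid relations\<close>

text \<open>Letters in neither relation form a bond of infinite order. The flag \<open>iv\<close>
  adds the squares of all letters and so turns the Artin group of a matrix into its Coxeter
  group.\<close>

definition arels :: "('a \<Rightarrow> 'a \<Rightarrow> bool) \<Rightarrow> ('a \<Rightarrow> 'a \<Rightarrow> bool) \<Rightarrow> bool \<Rightarrow> 'a word set" where
  "arels cm br iv = {relator [s, t] [t, s] | s t. cm s t}
     \<union> {relator [s, t, s] [t, s, t] | s t. br s t} \<union> {relator [s, s] [] | s. iv}"

definition arel_ok :: "('a \<Rightarrow> 'a \<Rightarrow> bool) \<Rightarrow> ('a \<Rightarrow> 'a \<Rightarrow> bool) \<Rightarrow> bool \<Rightarrow> ('a \<Rightarrow> 'g::group_add) \<Rightarrow> bool" where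
  "arel_ok cm br iv f \<longleftrightarrow> (\<forall>s t. cm s t \<longrightarrow> f s + f t = f t + f s)
     \<and> (\<forall>s t. br s t \<longrightarrow> f s + f t + f s = f t + f s + f t) \<and> (iv \<longrightarrow> (\<forall>s. f s + f s = 0))"

lemma arel_ok_iff: "arel_ok cm br iv f \<longleftrightarrow> (\<forall>r\<in>arels cm br iv. ev f r = 0)"
proof -
  have *: "(\<forall>r\<in>arels cm br iv. P r) \<longleftrightarrow> (\<forall>s t. cm s t \<longrightarrow> P (relator [s, t] [t, s]))
      \<and> (\<forall>s t. br s t \<longrightarrow> P (relator [s, t, s] [t, s, t])) \<and> (iv \<longrightarrow> (\<forall>s. P (relator [s, s] [])))"
    for P :: "'a word \<Rightarrow> bool"
    unfolding arels_def by blast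
  show ?thesis
    unfolding * arel_ok_def by (simp add: ev_relator add.assoc)
qed

locale coxeter_matrix =
  fixes cm br :: "'a \<Rightarrow> 'a \<Rightarrow> bool"
  assumes cm_sym: "cm s t \<Longrightarrow> cm t s" and br_sym: "br s t \<Longrightarrow> br t s"
    and cm_irrefl: "\<not> cm s s" and br_irrefl: "\<not> br s s" and not_cm_br: "\<not> (cm s t \<and> br s t)"
begin

definition gn :: "bool \<Rightarrow> 'a \<Rightarrow> 'a word set symgrp" where
  "gn iv = canon (arels cm br iv)"

lemma gn_ok: "arel_ok cm br iv (gn iv)"
  by (simp add: arel_ok_iff gn_def canon_rel)

lemma gn_commute: "cm s t \<Longrightarrow> gn iv s + gn iv t = gn iv t + gn iv s"
  and gn_braid: "br s t \<Longrightarrow> gn iv s + gn iv t + gn iv s = gn iv t + gn iv s + gn iv t"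
  using gn_ok[of iv] unfolding arel_ok_def by blast+

lemma gn_universal:
  assumes "arel_ok cm br iv f" "ev (gn iv) u = ev (gn iv) v"
  shows "ev f u = ev f v"
  using assms ev_canon_universal unfolding arel_ok_iff gn_def by metis

subsection \<open>The dual geometric representation\<close>

text \<open>These are the integers -2 cos(pi/m) for bonds of order m = 1, 2, 3 and infinity.\<close>

definition cartan :: "'a \<Rightarrow> 'a \<Rightarrow> int" where
  "cartan s t = (if s = t then 2 else if cm s t then 0 else if br s t then -1 else -2)"

text \<open>A function f is read as a linear form on the span of the simple roots, and the formula
  is precomposition with the reflection in the root of s. The dual is taken because its fundamental
  weights detect standard parabolic subgroups.\<close>

definition dual_refl :: "'a \<Rightarrow> ('a \<Rightarrow> int) \<Rightarrow> 'a \<Rightarrow> int" where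
  "dual_refl s f = (\<lambda>r. f r - cartan s r * f s)"

definition rho :: "'a \<Rightarrow> ('a \<Rightarrow> int) symgrp" where
  "rho s = Sym (dual_refl s)"

lemma dual_refl_twice: "dual_refl s (dual_refl s f) = f"
  by (auto simp: dual_refl_def cartan_def)

lemma app_rho [simp]: "app (rho s) = dual_refl s"
  unfolding rho_def by (intro involution_app dual_refl_twice)

lemma rho_rho: "rho s + rho s = 0"
  unfolding rho_def by (intro involution_app dual_refl_twice)

text \<open>The reflections are involutions, so the Artin group acts as well, through its Coxeter
  quotient.\<close>

lemma rho_ok: "arel_ok cm br iv rho"
proof -
  have "dual_refl t (dual_refl s f) = dual_refl s (dual_refl t f)" if "cm s t" for s t f
  proof -
    have "cartan s t = 0" "cartan t s = 0" using that cm_irrefl cm_sym by (auto simp: cartan_def)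
    then show ?thesis by (auto simp: dual_refl_def)
  qed
  moreover have "dual_refl s (dual_refl t (dual_refl s f)) = dual_refl t (dual_refl s (dual_refl t f))"
    if "br s t" for s t f
  proof -
    have "cartan s t = -1" "cartan t s = -1" "cartan s s = 2" "cartan t t = 2"
      using that br_irrefl br_sym cm_sym not_cm_br unfolding cartan_def by metis+
    then show ?thesis by (auto simp: dual_refl_def algebra_simps)
  qed
  ultimately show ?thesis
    by (auto simp: arel_ok_def rho_rho intro!: symgrp_eqI)
qed

definition fund :: "'a \<Rightarrow> 'a \<Rightarrow> int" where
  "fund z = (\<lambda>r. if r = z then 1 else 0)"

text \<open>The reflection of s changes a form by a multiple of its value at s, and
  \<open>fund z\<close> vanishes at every letter other than z.\<close>

lemma rho_fund:
  assumes "w \<in> lists (Sigma Y (\<lambda>_. UNIV))" "z \<notin> Y"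
  shows "app (ev rho w) (fund z) = fund z"
  using assms(1)
proof (induction w)
  case (Cons l w)
  obtain s b where l: "l = (s, b)" by force
  have "- rho s = rho s" by (metis rho_rho minus_unique)
  moreover have "dual_refl s (fund z) = fund z"
    using Cons assms(2) by (auto simp: l dual_refl_def fund_def)
  ultimately show ?case using Cons by (auto simp: l)
qed simp

lemma gspan_rho_fund:
  assumes "ev (gn iv) w \<in> gspan (gn iv) Y" "z \<notin> Y"
  shows "app (ev rho w) (fund z) = fund z"
proof -
  obtain v where "v \<in> lists (Sigma Y (\<lambda>_. UNIV))" "ev (gn iv) w = ev (gn iv) v"
    using assms(1) by (auto simp: gspan_def)
  then show ?thesis using rho_fund[of v Y z] gn_universal[OF rho_ok] assms(2) by metis
qed

lemma gn_in_gspan_iff: "gn iv z \<in> gspan (gn iv) Y \<longleftrightarrow> z \<in> Y"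
proof
  assume "gn iv z \<in> gspan (gn iv) Y"
  then have "z \<notin> Y \<Longrightarrow> app (ev rho [(z, True)]) (fund z) = fund z"
    by (intro gspan_rho_fund) simp
  then have "z \<notin> Y \<Longrightarrow> dual_refl z (fund z) z = fund z z" by simp
  then show "z \<in> Y" by (auto simp: dual_refl_def fund_def cartan_def)
qed (rule gspan_gen)

lemma gn_inject: "gn iv s = gn iv t \<longleftrightarrow> s = t"
  using gn_in_gspan_iff[of iv s "{t}"] gspan_gen[of t "{t}" "gn iv"] by auto

text \<open>Both orders are applied to \<open>fund s\<close> and compared at s: the results are -1 +
  \<open>cartan s t * cartan t s\<close> and -1.\<close>

lemma commute_imp_cm:
  assumes "gn iv s + gn iv t = gn iv t + gn iv s" "s \<noteq> t"
  shows "cm s t"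
proof -
  have "ev rho [(s, True), (t, True)] = ev rho [(t, True), (s, True)]"
    by (rule gn_universal[OF rho_ok, of iv]) (simp add: assms(1))
  then have "app (ev rho [(s, True), (t, True)]) (fund s) s = app (ev rho [(t, True), (s, True)]) (fund s) s"
    by simp
  then have "cartan s t * cartan t s = 0"
    using assms(2) by (auto simp: dual_refl_def fund_def)
  then show ?thesis using assms(2) cm_sym by (auto simp: cartan_def split: if_splits)
qed

lemma braid_imp_br:
  assumes "gn iv s + gn iv t + gn iv s = gn iv t + gn iv s + gn iv t" "s \<noteq> t"
  shows "br s t"
proof -
  have "ev rho [(s, True), (t, True), (s, True)] = ev rho [(t, True), (s, True), (t, True)]"
    by (rule gn_universal[OF rho_ok, of iv]) (simp add: assms(1) flip: add.assoc)
  then have "app (ev rho [(s, True), (t, True), (s, True)]) (fund s) s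
      = app (ev rho [(t, True), (s, True), (t, True)]) (fund s) s"
    by simp
  moreover have "cartan s s = 2" by (simp add: cartan_def)
  ultimately have "cartan s t * cartan t s = 1"
    using assms(2) by (simp add: dual_refl_def fund_def)
  then show ?thesis using assms(2) br_sym by (auto simp: cartan_def split: if_splits)
qed

text \<open>On the values at s and z the product of the two reflections is unipotent; its p-th power
  gives \<open>fund s\<close> the value 2p + 1 at s instead of 1. The three exponents are those
  needed in \<open>avoid_cosets\<close>.\<close>

lemma infinite_order:
  assumes "s \<noteq> z" "\<not> cm s z" "\<not> br s z" "s \<notin> Y" "p \<in> {1, 2, 3 :: nat}"
  shows "ev (gn iv) (concat (replicate p [(s, True), (z, True)])) \<notin> gspan (gn iv) Y"
proof
  assume "ev (gn iv) (concat (replicate p [(s, True), (z, True)])) \<in> gspan (gn iv) Y"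
  from gspan_rho_fund[OF this assms(4)]
  have "app (ev rho (concat (replicate p [(s, True), (z, True)]))) (fund s) s = 1"
    by (simp add: fund_def)
  moreover have "cartan s s = 2" "cartan z z = 2" "cartan s z = -2" "cartan z s = -2"
    using assms cm_sym br_sym by (auto simp: cartan_def)
  ultimately show False
    using assms(1,5) by (auto simp: dual_refl_def fund_def numeral_eq_Suc)
qed

subsection \<open>Reflections and signs in the Coxeter group\<close>

abbreviation yg :: "'a \<Rightarrow> 'a word set symgrp" where
  "yg \<equiv> gn True"

lemma yg_yg: "yg s + yg s = 0"
  using gn_ok[of True] by (simp add: arel_ok_def)

lemma minus_yg [simp]: "- yg s = yg s"
  by (metis yg_yg minus_unique)

lemma yg_cancel [simp]: "yg s + (yg s + q) = q"
  by (metis add.assoc yg_yg add_0)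

text \<open>The classical action on signed reflections: conjugate by s and change the sign exactly
  at s. Admitting all group elements u spares a description of the reflections.\<close>

definition sign_step :: "'a \<Rightarrow> 'a word set symgrp \<times> bool \<Rightarrow> 'a word set symgrp \<times> bool" where
  "sign_step s = (\<lambda>(u, e). (yg s + u + yg s, e \<noteq> (u = yg s)))"

definition zeta :: "'a \<Rightarrow> ('a word set symgrp \<times> bool) symgrp" where
  "zeta s = Sym (sign_step s)"

lemma conj_yg_eq: "yg s + u + yg s = v \<longleftrightarrow> u = yg s + v + yg s"
  by (auto simp: add.assoc yg_yg)

lemma sign_step_twice: "sign_step s (sign_step s p) = p"
  by (cases p) (simp add: sign_step_def conj_yg_eq[of _ _ "yg s"], auto simp: add.assoc yg_yg)

lemma app_zeta [simp]: "app (zeta s) = sign_step s"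
  unfolding zeta_def by (intro involution_app sign_step_twice)

lemma zeta_zeta: "zeta s + zeta s = 0"
  unfolding zeta_def by (intro involution_app sign_step_twice)

lemma minus_zeta [simp]: "- zeta s = zeta s"
  by (metis zeta_zeta minus_unique)

text \<open>The two sides of a relation change signs at the same elements: s and t when the letters
  commute, and also the common value of sts and tst in the braid case.\<close>

lemma zeta_ok: "arel_ok cm br True zeta"
proof -
  have "sign_step t (sign_step s p) = sign_step s (sign_step t p)" if "cm s t" for s t p
  proof -
    have c: "yg s + yg t = yg t + yg s" using that by (rule gn_commute)
    have d: "yg s + (yg t + q) = yg t + (yg s + q)" for q by (metis add.assoc c)
    have "yg s + yg t + yg s = yg t" "yg t + yg s + yg t = yg s"
      by (metis add.assoc c yg_cancel)+
    then have "yg s + u + yg s = yg t \<longleftrightarrow> u = yg t" "yg t + u + yg t = yg s \<longleftrightarrow> u = yg s" for u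
      by (simp_all add: conj_yg_eq)
    then show ?thesis
      by (cases p) (auto simp: sign_step_def, auto simp: add.assoc c d)
  qed
  moreover have "sign_step s (sign_step t (sign_step s p)) = sign_step t (sign_step s (sign_step t p))"
    if "br s t" for s t p
  proof -
    have c: "yg s + (yg t + yg s) = yg t + (yg s + yg t)"
      using gn_braid[OF that] by (simp only: add.assoc)
    have d: "yg s + (yg t + (yg s + q)) = yg t + (yg s + (yg t + q))" for q by (metis add.assoc c)
    have "yg s + (yg t + yg s + yg t) + yg s = yg t" "yg t + (yg s + yg t + yg s) + yg t = yg s"
      "yg s + yg t + yg s = yg t + yg s + yg t" "yg t + (yg t + yg s + yg t) + yg t = yg s"
      by (simp_all add: add.assoc c d yg_yg)
    note e = this
    have "yg t + (yg s + u + yg s) + yg t = yg s \<longleftrightarrow> u = yg t"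
      "yg s + (yg t + u + yg t) + yg s = yg t \<longleftrightarrow> u = yg s"
      "yg s + u + yg s = yg t \<longleftrightarrow> u = yg t + yg s + yg t"
      "yg t + u + yg t = yg s \<longleftrightarrow> u = yg t + yg s + yg t"
      for u
      by (simp_all only: conj_yg_eq e)
    then show ?thesis
      by (cases p) (auto simp: sign_step_def, auto simp: add.assoc c d)
  qed
  ultimately show ?thesis
    by (auto simp: arel_ok_def zeta_zeta intro!: symgrp_eqI)
qed

text \<open>\<open>flips w u\<close> tells whether the reflection \<open>u\<close> is an inversion of the element represented by \<open>w\<close>.\<close>

definition flips :: "'a word \<Rightarrow> 'a word set symgrp \<Rightarrow> bool" where
  "flips w u = snd (app (ev zeta w) (u, False))"

lemma app_ev_zeta: "app (ev zeta w) (u, e) = (- ev yg w + u + ev yg w, e \<noteq> flips w u)"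
proof (induction w arbitrary: u e)
  case (Cons l w)
  obtain s b where l: "l = (s, b)" by force
  show ?case
    by (auto simp: l flips_def[of "_ # _"] sign_step_def Cons.IH gsimps simp del: add_uminus_conv_diff)
qed (simp add: flips_def)

lemma flips_append: "flips (w @ v) u \<longleftrightarrow> flips w u \<noteq> flips v (- ev yg w + u + ev yg w)"
  unfolding flips_def[of "w @ v"] by (simp add: app_ev_zeta)

lemma flips_Cons: "flips ((s, b) # w) u \<longleftrightarrow> (u = yg s) \<noteq> flips w (yg s + u + yg s)"
  using app_ev_zeta[of w "yg s + u + yg s" "u = yg s"]
  by (simp add: flips_def[of "_ # _"] sign_step_def)

lemma flips_Nil [simp]: "\<not> flips [] u"
  by (simp add: flips_def)

text \<open>The gain from the signed action: inversions, computed letter by letter, belong to the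
  group element.\<close>

lemma flips_cong: "ev yg w = ev yg v \<Longrightarrow> flips w = flips v"
  using gn_universal[OF zeta_ok, of w v] by (simp add: flips_def fun_eq_iff)

text \<open>The elements of minimal length in their right coset of the parabolic subgroup of \<open>U\<close>.\<close>

definition minreps :: "'a set \<Rightarrow> 'a word set symgrp set" where
  "minreps U = {q. \<exists>w. q = ev yg w \<and> (\<forall>x\<in>U. \<not> flips w (yg x))}"

lemma zero_minreps: "0 \<in> minreps U"
  unfolding minreps_def by (auto intro!: exI[of _ "[]"])

lemma ev_minreps_iff: "ev yg w \<in> minreps U \<longleftrightarrow> (\<forall>x\<in>U. \<not> flips w (yg x))"
proof
  assume "ev yg w \<in> minreps U"
  then obtain v where v: "ev yg w = ev yg v" "\<forall>x\<in>U. \<not> flips v (yg x)"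
    unfolding minreps_def by blast
  show "\<forall>x\<in>U. \<not> flips w (yg x)" using v(2) unfolding flips_cong[OF v(1)] .
qed (auto simp: minreps_def)

text \<open>Deodhar's lemma. Appending s to q affects only the inversion qsq^-1, so minimality is
  lost exactly when this is some generator x from U; then qs = xq lies in the coset of q.\<close>

lemma minreps_step:
  assumes "q \<in> minreps U"
  shows "q + yg s \<in> minreps U \<longleftrightarrow> q + yg s - q \<notin> yg ` U"
proof -
  obtain w where w: "q = ev yg w" using assms unfolding minreps_def by blast
  have eq: "- q + u + q = yg s \<longleftrightarrow> q + yg s - q = u" for u
  proof
    assume "- q + u + q = yg s"
    then have "q + yg s - q = q + (- q + u + q) - q" by simp
    then show "q + yg s - q = u" by (simp add: gsimps del: add_uminus_conv_diff)
  next
    assume "q + yg s - q = u"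
    then have "- q + u + q = - q + (q + yg s - q) + q" by simp
    then show "- q + u + q = yg s" by (simp add: gsimps del: add_uminus_conv_diff)
  qed
  have "q + yg s \<in> minreps U \<longleftrightarrow> (\<forall>x\<in>U. \<not> flips (w @ [(s, True)]) (yg x))"
    using ev_minreps_iff[of "w @ [(s, True)]" U] by (simp add: w)
  also have "\<dots> \<longleftrightarrow> (\<forall>x\<in>U. \<not> (- q + yg x + q = yg s))"
    using assms ev_minreps_iff[of w U] by (simp add: flips_append flips_Cons w)
  finally show ?thesis unfolding eq by blast
qed

text \<open>Along the word aca the sign of the reflection a changes at the first letter only, and
  the reflection reaches q as c, where the minimal q does not change the sign again. So a is an
  inversion of acaq.\<close>

lemma minreps_braid:
  assumes "q \<in> minreps U" "a \<in> U" "c \<in> U" "a \<noteq> c"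
    and braid: "yg a + yg c + yg a = yg c + yg a + yg c"
  shows "yg a + yg c + yg a + q \<notin> minreps U"
proof -
  obtain w where w: "q = ev yg w" using assms unfolding minreps_def by blast
  have ne: "yg a \<noteq> yg c" using assms(4) by (simp add: gn_inject)
  have ne': "yg c + (yg a + yg c) \<noteq> yg a"
  proof
    assume *: "yg c + (yg a + yg c) = yg a"
    then have "yg a + (yg c + yg a) = yg a + 0" using braid by (simp add: add.assoc)
    then show False using ne minus_yg by (metis add_left_cancel minus_unique)
  qed
  have "yg a + (yg c + (yg a + (yg c + yg a))) = yg c"
    using braid by (metis add.assoc yg_cancel yg_yg add_0_right)
  then have "flips ([(a, True), (c, True), (a, True)] @ w) (yg a)"
    using ne ne' assms(1,3) ev_minreps_iff[of w U] by (simp add: flips_Cons w add.assoc yg_yg)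
  then show ?thesis
    using ev_minreps_iff[of "[(a, True), (c, True), (a, True)] @ w" U] assms(2) by (auto simp: w add.assoc)
qed

subsection \<open>The set retraction onto a parabolic subgroup\<close>

definition lab :: "'a set \<Rightarrow> 'a word set symgrp \<Rightarrow> 'a \<Rightarrow> 'a" where
  "lab U q s = (THE x. x \<in> U \<and> yg x = q + yg s - q)"

lemma lab_eq: "x \<in> U \<Longrightarrow> yg x = q + yg s - q \<Longrightarrow> lab U q s = x"
  unfolding lab_def using gn_inject[of True _ x] by (intro the_equality) simp_all

text \<open>A state is a position q and the product a recorded so far. States with a position that
  is not minimal are fixed, so that the step permutes the whole type.\<close>

definition retr_step ::
  "('a \<Rightarrow> 'g::group_add) \<Rightarrow> 'a set \<Rightarrow> 'a \<Rightarrow> 'a word set symgrp \<times> 'g \<Rightarrow> 'a word set symgrp \<times> 'g" where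
  "retr_step f U s = (\<lambda>(q, a). if q \<notin> minreps U then (q, a)
     else if q + yg s \<in> minreps U then (q + yg s, a) else (q, a + f (lab U q s)))"

definition retr :: "('a \<Rightarrow> 'g::group_add) \<Rightarrow> 'a set \<Rightarrow> 'a \<Rightarrow> ('a word set symgrp \<times> 'g) symgrp" where
  "retr f U s = Sym (retr_step f U s)"

text \<open>Positions live in the Coxeter group, so a letter and its inverse move them alike; only
  the recorded letter is inverted.\<close>

lemma retr_step_inverse: "retr_step (\<lambda>x. - f x) U s (retr_step f U s p) = p"
  by (auto simp: retr_step_def add.assoc yg_yg split: prod.splits if_splits)

lemma app_retr [simp]:
  "app (retr f U s) = retr_step f U s" "app (- retr f U s) = retr_step (\<lambda>x. - f x) U s"
proof -
  have m: "retr_step f U s (retr_step (\<lambda>x. - f x) U s p) = p" for p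
    using retr_step_inverse[of "\<lambda>x. - f x" U s p] by simp
  have "bij (retr_step f U s)"
    using m retr_step_inverse by (intro o_bij[of "retr_step (\<lambda>x. - f x) U s"]) (auto simp: fun_eq_iff)
  then show 1: "app (retr f U s) = retr_step f U s" by (simp add: retr_def app_Sym)
  show "app (- retr f U s) = retr_step (\<lambda>x. - f x) U s"
    unfolding app_uminus 1 by (rule inv_equality) (simp_all add: m retr_step_inverse)
qed

lemma retr_step_move:
  "q \<in> minreps U \<Longrightarrow> q + yg s - q \<notin> yg ` U \<Longrightarrow> retr_step f U s (q, a) = (q + yg s, a)"
  by (simp add: retr_step_def minreps_step)

lemma retr_step_stay:
  "q \<in> minreps U \<Longrightarrow> x \<in> U \<Longrightarrow> q + yg s - q = yg x \<Longrightarrow> retr_step f U s (q, a) = (q, a + f x)"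
  using lab_eq[of x U q s] by (simp add: retr_step_def minreps_step)

text \<open>Conjugation by t fixes s, so qsq^-1 is the same before and after a move by t, and each
  letter makes the same kind of step in either order. If both stay, the recorded letters commute in
  the Coxeter group, hence are related by \<open>cm\<close>.\<close>

lemma retr_commute:
  assumes ok: "arel_ok cm br iv f" and "cm s t"
  shows "retr_step f U t (retr_step f U s (q, a)) = retr_step f U s (retr_step f U t (q, a))"
proof (cases "q \<in> minreps U")
  case q: True
  have c: "yg s + yg t = yg t + yg s" using assms(2) by (rule gn_commute)
  have st: "q + yg s + yg t = q + yg t + yg s" using c by (simp add: add.assoc)
  have A: "q + yg t + yg s - (q + yg t) = q + yg s - q"
    unfolding st[symmetric] by (simp add: gsimps c[symmetric] yg_yg del: add_uminus_conv_diff)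
  have B: "q + yg s + yg t - (q + yg s) = q + yg t - q"
    unfolding st by (simp add: gsimps c yg_yg del: add_uminus_conv_diff)
  show ?thesis
  proof (cases "q + yg s - q \<in> yg ` U"; cases "q + yg t - q \<in> yg ` U")
    assume "q + yg s - q \<in> yg ` U" "q + yg t - q \<in> yg ` U"
    then obtain x z where x: "x \<in> U" "q + yg s - q = yg x" and z: "z \<in> U" "q + yg t - q = yg z"
      by blast
    have "yg x + yg z = yg z + yg x"
      unfolding x(2)[symmetric] z(2)[symmetric] using st
      by (simp add: gsimps c del: add_uminus_conv_diff) (metis add.assoc c)
    moreover have "x \<noteq> z"
      using x z assms(2) cm_irrefl by (metis add_left_cancel diff_add_cancel gn_inject)
    ultimately have "cm x z" by (rule commute_imp_cm)
    then have "f x + f z = f z + f x" using ok unfolding arel_ok_def by blast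
    then show ?thesis by (simp add: retr_step_stay[OF q x] retr_step_stay[OF q z] add.assoc)
  next
    assume "q + yg s - q \<in> yg ` U" and t: "q + yg t - q \<notin> yg ` U"
    then obtain x where x: "x \<in> U" "q + yg s - q = yg x" by blast
    have qt: "q + yg t \<in> minreps U" using q t by (simp add: minreps_step)
    show ?thesis
      using retr_step_stay[OF qt x(1), of s f a] x(2) A
      by (simp add: retr_step_stay[OF q x] retr_step_move[OF q t])
  next
    assume s: "q + yg s - q \<notin> yg ` U" and "q + yg t - q \<in> yg ` U"
    then obtain x where x: "x \<in> U" "q + yg t - q = yg x" by blast
    have qs: "q + yg s \<in> minreps U" using q s by (simp add: minreps_step)
    show ?thesis
      using retr_step_stay[OF qs x(1), of t f a] x(2) B
      by (simp add: retr_step_stay[OF q x] retr_step_move[OF q s])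
  next
    assume s: "q + yg s - q \<notin> yg ` U" and t: "q + yg t - q \<notin> yg ` U"
    have qs: "q + yg s \<in> minreps U" using q s by (simp add: minreps_step)
    have qt: "q + yg t \<in> minreps U" using q t by (simp add: minreps_step)
    show ?thesis
      using retr_step_move[OF qs, of t f a] retr_step_move[OF qt, of s f a] A B s t
      by (simp add: retr_step_move[OF q s] retr_step_move[OF q t] st)
  qed
qed (simp add: retr_step_def)

text \<open>If the walk moved by t and then stayed with record z, then x and z would satisfy the
  braid relation and xzxq = qt. By \<open>minreps_braid\<close> this element is not minimal,
  although the walk moved there.\<close>

lemma retr_braid_aux:
  assumes q: "q \<in> minreps U" and "br s t"
    and x: "x \<in> U" "q + yg s - q = yg x" and t: "q + yg t - q \<notin> yg ` U"
  shows "q + yg t + yg s - (q + yg t) \<notin> yg ` U"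
proof
  assume "q + yg t + yg s - (q + yg t) \<in> yg ` U"
  then obtain z where z: "z \<in> U" "q + yg t + yg s - (q + yg t) = yg z" by blast
  have c: "yg s + (yg t + yg s) = yg t + (yg s + yg t)"
    using gn_braid[OF assms(2), of True] by (simp only: add.assoc)
  have d: "yg s + (yg t + (yg s + u)) = yg t + (yg s + (yg t + u))" for u by (metis add.assoc c)
  have "x \<noteq> z"
  proof
    assume "x = z"
    then have "q + yg t + yg s - (q + yg t) = q + yg s - q" using x z by simp
    then have "yg t + yg s + yg t + - q = yg s + - q"
      by (simp add: gsimps del: add_uminus_conv_diff)
    then have "yg t + (yg s + yg t) = yg s"
      by (simp only: add_right_cancel add.assoc[symmetric])
    then have "yg t + yg s = 0" using c by (metis add_0_right add_left_cancel)
    then have "yg t = yg s" by (metis minus_unique minus_yg)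
    then show False using assms(2) br_irrefl by (simp add: gn_inject)
  qed
  moreover have "yg x + yg z + yg x = q + yg t - q"
    unfolding x(2)[symmetric] z(2)[symmetric]
    by (simp add: gsimps c d yg_yg del: add_uminus_conv_diff)
  moreover have "yg z + yg x + yg z = q + yg t - q"
    unfolding x(2)[symmetric] z(2)[symmetric]
    by (simp add: gsimps c d yg_yg del: add_uminus_conv_diff)
  ultimately have "q + yg t - q + q \<notin> minreps U"
    using minreps_braid[OF q x(1) z(1)] by simp
  then show False using q t by (simp add: minreps_step)
qed

lemma retr_braid:
  assumes ok: "arel_ok cm br iv f" and "br s t"
  shows "retr_step f U s (retr_step f U t (retr_step f U s (q, a)))
    = retr_step f U t (retr_step f U s (retr_step f U t (q, a)))"
proof (cases "q \<in> minreps U")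
  case q: True
  have c: "yg s + (yg t + yg s) = yg t + (yg s + yg t)"
    using gn_braid[OF assms(2), of True] by (simp only: add.assoc)
  have d: "yg s + (yg t + (yg s + u)) = yg t + (yg s + (yg t + u))" for u by (metis add.assoc c)
  \<comment> \<open>The conjugates by q of the three reflections in the dihedral group of s and t.
    Which of them are generators from U decides where the walk stays.\<close>
  define A B C where "A = q + yg s - q" and "B = q + yg t - q" and "C = A + B + A"
  have ts: "q + yg t + yg s - (q + yg t) = C"
    and st: "q + yg s + yg t - (q + yg s) = C"
    and sts: "q + yg s + yg t + yg s - (q + yg s + yg t) = B"
    and tst: "q + yg t + yg s + yg t - (q + yg t + yg s) = A"
    and sts': "q + yg s + yg t + yg s = q + yg t + yg s + yg t"
    and ss: "q + yg s + yg s - (q + yg s) = A" "q + yg s + yg s = q"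
    and tt: "q + yg t + yg t - (q + yg t) = B" "q + yg t + yg t = q"
    by (simp_all add: A_def B_def C_def gsimps c d yg_yg del: add_uminus_conv_diff)
  have ms: "A \<notin> yg ` U \<Longrightarrow> q + yg s \<in> minreps U" and mt: "B \<notin> yg ` U \<Longrightarrow> q + yg t \<in> minreps U"
    using q by (simp_all add: minreps_step A_def B_def)
  have mst: "q + yg s \<in> minreps U \<Longrightarrow> C \<notin> yg ` U \<Longrightarrow> q + yg s + yg t \<in> minreps U"
    and mts: "q + yg t \<in> minreps U \<Longrightarrow> C \<notin> yg ` U \<Longrightarrow> q + yg t + yg s \<in> minreps U"
    using minreps_step[of "q + yg s" U t] minreps_step[of "q + yg t" U s] st ts by simp_all
  show ?thesis
  proof (cases "A \<in> yg ` U"; cases "B \<in> yg ` U")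
    assume "A \<in> yg ` U" "B \<in> yg ` U"
    then obtain x z where x: "x \<in> U" "q + yg s - q = yg x" and z: "z \<in> U" "q + yg t - q = yg z"
      unfolding A_def B_def by blast
    have "yg x + yg z + yg x = yg z + yg x + yg z"
      unfolding x(2)[symmetric] z(2)[symmetric]
      by (simp add: gsimps c d yg_yg del: add_uminus_conv_diff)
    moreover have "x \<noteq> z"
      using x z assms(2) br_irrefl by (metis add_left_cancel diff_add_cancel gn_inject)
    ultimately have "br x z" by (rule braid_imp_br)
    then have "f x + f z + f x = f z + f x + f z" using ok unfolding arel_ok_def by blast
    then show ?thesis by (simp add: retr_step_stay[OF q x] retr_step_stay[OF q z] add.assoc)
  next
    assume a: "A \<in> yg ` U" and b: "B \<notin> yg ` U"
    then obtain x where x: "x \<in> U" "q + yg s - q = yg x" unfolding A_def by blast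
    have C: "C \<notin> yg ` U" using retr_braid_aux[OF q assms(2) x] b ts unfolding B_def by simp
    note m = mt[OF b] mts[OF mt[OF b] C]
    have "retr_step f U s (q + yg t, r) = (q + yg t + yg s, r)"
      "retr_step f U t (q + yg t + yg s, r) = (q + yg t + yg s, r + f x)" for r
      using retr_step_move[OF m(1), of s] C ts retr_step_stay[OF m(2) x(1), of t] tst x(2)
      by (simp_all add: A_def)
    then show ?thesis
      by (simp add: retr_step_stay[OF q x] retr_step_move[OF q b[unfolded B_def]])
  next
    assume a: "A \<notin> yg ` U" and b: "B \<in> yg ` U"
    then obtain x where x: "x \<in> U" "q + yg t - q = yg x" unfolding B_def by blast
    have C: "C \<notin> yg ` U"
      using retr_braid_aux[OF q br_sym[OF assms(2)] x] a st unfolding A_def by simp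
    note m = ms[OF a] mst[OF ms[OF a] C]
    have "retr_step f U t (q + yg s, r) = (q + yg s + yg t, r)"
      "retr_step f U s (q + yg s + yg t, r) = (q + yg s + yg t, r + f x)" for r
      using retr_step_move[OF m(1), of t] C st retr_step_stay[OF m(2) x(1), of s] sts x(2)
      by (simp_all add: B_def)
    then show ?thesis
      by (simp add: retr_step_stay[OF q x] retr_step_move[OF q a[unfolded A_def]])
  next
    assume a: "A \<notin> yg ` U" and b: "B \<notin> yg ` U"
    show ?thesis
    proof (cases "C \<in> yg ` U")
      \<comment> \<open>In both orders the walk moves, stays with record x, and moves back to
        q.\<close>
      case True
      then obtain x where x: "x \<in> U" "C = yg x" by blast
      have "retr_step f U t (q + yg s, r) = (q + yg s, r + f x)"
        "retr_step f U s (q + yg t, r) = (q + yg t, r + f x)"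
        "retr_step f U s (q + yg s, r) = (q, r)" "retr_step f U t (q + yg t, r) = (q, r)" for r
        using retr_step_stay[OF ms[OF a] x(1), of t] retr_step_stay[OF mt[OF b] x(1), of s] x(2) st ts
          retr_step_move[OF ms[OF a], of s] retr_step_move[OF mt[OF b], of t] a b ss tt
        by simp_all
      then show ?thesis
        by (simp add: retr_step_move[OF q a[unfolded A_def]] retr_step_move[OF q b[unfolded B_def]])
    next
      case C: False
      have "retr_step f U t (q + yg s, r) = (q + yg s + yg t, r)"
        "retr_step f U s (q + yg t, r) = (q + yg t + yg s, r)"
        "retr_step f U s (q + yg s + yg t, r) = (q + yg s + yg t + yg s, r)"
        "retr_step f U t (q + yg t + yg s, r) = (q + yg t + yg s + yg t, r)" for r
        using retr_step_move[OF ms[OF a], of t] retr_step_move[OF mt[OF b], of s]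
          retr_step_move[OF mst[OF ms[OF a] C], of s] retr_step_move[OF mts[OF mt[OF b] C], of t]
          a b C st ts sts tst
        by simp_all
      then show ?thesis
        by (simp add: retr_step_move[OF q a[unfolded A_def]] retr_step_move[OF q b[unfolded B_def]] sts')
    qed
  qed
qed (simp add: retr_step_def)

lemma retr_ok:
  assumes "arel_ok cm br iv f"
  shows "arel_ok cm br iv (retr f U)"
proof -
  have "retr_step f U s (retr_step f U s p) = p" if iv for s p
  proof -
    have "f x + f x = 0" for x using that assms unfolding arel_ok_def by blast
    then show ?thesis by (cases p) (auto simp: retr_step_def add.assoc yg_yg)
  qed
  then show ?thesis
    using retr_commute[OF assms] retr_braid[OF assms]
    unfolding arel_ok_def by (auto intro!: symgrp_eqI)
qed

lemma retr_id:
  assumes "w \<in> lists (Sigma U (\<lambda>_. UNIV))"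
  shows "app (ev (retr f U) w) (0, a) = (0, a + ev f w)"
  using assms
proof (induction w arbitrary: a)
  case (Cons l w)
  obtain s b where l: "l = (s, b)" by force
  have *: "app (retr f U s) (0, a) = (0, a + f s)" for a
    using Cons retr_step_stay[OF zero_minreps, of s U s f a] by (simp add: l)
  have "app (- retr f U s) (0, a) = (0, a - f s)"
    unfolding app_uminus using *[of "a - f s"]
    by (intro inv_f_eq) (simp_all add: bij_app bij_is_inj del: app_retr)
  then show ?case using * Cons by (simp add: l add.assoc[symmetric] del: app_retr)
qed simp

text \<open>Along a word over Y the position stays in the subgroup of Y. A recorded x equals qsq^-1,
  so it lies in that subgroup too, and \<open>gn_in_gspan_iff\<close> puts x into Y.\<close>

lemma retr_walk:
  assumes "w \<in> lists (Sigma Y (\<lambda>_. UNIV))" "q \<in> gspan yg Y" "a \<in> gspan f (U \<inter> Y)"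
  shows "fst (app (ev (retr f U) w) (q, a)) \<in> gspan yg Y \<and> snd (app (ev (retr f U) w) (q, a)) \<in> gspan f (U \<inter> Y)"
  using assms
proof (induction w arbitrary: q a)
  case (Cons l w)
  obtain s b where l: "l = (s, b)" by force
  have s: "s \<in> Y" using Cons by (simp add: l)
  have step: "fst (retr_step h U s (q, a)) \<in> gspan yg Y \<and> snd (retr_step h U s (q, a)) \<in> gspan f (U \<inter> Y)"
    if h: "\<And>x. x \<in> U \<inter> Y \<Longrightarrow> h x \<in> gspan f (U \<inter> Y)" for h
  proof -
    have qs: "q + yg s \<in> gspan yg Y" using Cons.prems s by (simp add: gspan_add gspan_gen)
    show ?thesis
    proof (cases "q \<in> minreps U \<and> q + yg s \<notin> minreps U")
      case True
      then obtain x where x: "x \<in> U" "q + yg s - q = yg x" using minreps_step by blast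
      have "yg x \<in> gspan yg Y"
        using gspan_add[OF qs gspan_uminus[OF Cons.prems(1)]] x(2) by simp
      then have "h x \<in> gspan f (U \<inter> Y)" using x(1) h by (simp add: gn_in_gspan_iff)
      then show ?thesis
        using True Cons.prems by (simp add: retr_step_stay[OF _ x] gspan_add)
    next
      case False
      then show ?thesis using Cons.prems qs by (auto simp: retr_step_def)
    qed
  qed
  have steps: "fst (app (if b then retr f U s else - retr f U s) (q, a)) \<in> gspan yg Y
    \<and> snd (app (if b then retr f U s else - retr f U s) (q, a)) \<in> gspan f (U \<inter> Y)"
    using step[of f] step[of "\<lambda>x. - f x"] by (auto simp: gspan_gen gspan_uminus)
  show ?case
    using Cons.IH[of "fst (app (if b then retr f U s else - retr f U s) (q, a))"
        "snd (app (if b then retr f U s else - retr f U s) (q, a))"] Cons.prems steps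
    by (simp add: l del: app_retr)
qed simp

theorem gspan_Int: "gspan (gn iv) U \<inter> gspan (gn iv) Y = gspan (gn iv) (U \<inter> Y)"
proof
  show "gspan (gn iv) U \<inter> gspan (gn iv) Y \<subseteq> gspan (gn iv) (U \<inter> Y)"
  proof
    fix g assume "g \<in> gspan (gn iv) U \<inter> gspan (gn iv) Y"
    then obtain u v where u: "u \<in> lists (Sigma U (\<lambda>_. UNIV))" "g = ev (gn iv) u"
      and v: "v \<in> lists (Sigma Y (\<lambda>_. UNIV))" "g = ev (gn iv) v"
      unfolding gspan_def by blast
    \<comment> \<open>Along u the walk never leaves 0 and records g; along v it records an element
      of the subgroup of U \<inter> Y. Both words represent g, so the records agree.\<close>
    have "ev (retr (gn iv) U) u = ev (retr (gn iv) U) v"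
      using u v by (intro gn_universal[OF retr_ok[OF gn_ok]]) simp
    then show "g \<in> gspan (gn iv) (U \<inter> Y)"
      using retr_id[OF u(1), of "gn iv" 0] retr_walk[OF v(1) gspan_zero gspan_zero, of "gn iv" U] u(2)
      by simp
  qed
qed (use gspan_mono[of "U \<inter> Y" U "gn iv"] gspan_mono[of "U \<inter> Y" Y "gn iv"] in blast)

end

subsection \<open>Splitting along a pair of generators without relation\<close>

text \<open>For each letter of the pair, \<open>third\<close> gives a further letter without
  relation to it; the powers of their product furnish enough cosets of the amalgamated subgroup in
  each factor.\<close>

locale free_pair = coxeter_matrix +
  fixes S :: "'a set" and s t :: 'a
  assumes cm_S: "cm u v \<Longrightarrow> u \<in> S" and br_S: "br u v \<Longrightarrow> u \<in> S"
    and st: "s \<in> S" "t \<in> S" "s \<noteq> t" "\<not> cm s t" "\<not> br s t"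
    and third: "\<exists>z\<in>S. z \<noteq> s \<and> z \<noteq> t \<and> \<not> cm s z \<and> \<not> br s z"
      "\<exists>z\<in>S. z \<noteq> s \<and> z \<noteq> t \<and> \<not> cm t z \<and> \<not> br t z"
  fixes iv :: bool
begin

abbreviation x where "x \<equiv> gn iv"

abbreviation excl :: "bool \<Rightarrow> 'a" where
  "excl b \<equiv> (if b then t else s)"

definition C where "C = gspan x (S - {s, t})"

definition G where "G b = gspan x (S - {excl b})"

lemma G_Int: "g \<in> G b \<Longrightarrow> g \<in> G (\<not> b) \<Longrightarrow> g \<in> C"
proof -
  have "(S - {t}) \<inter> (S - {s}) = S - {s, t}" by blast
  then show "g \<in> G b \<Longrightarrow> g \<in> G (\<not> b) \<Longrightarrow> g \<in> C"
    using gspan_Int[of iv "S - {t}" "S - {s}"] unfolding G_def C_def by (cases b) auto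
qed

lemma C_sub_G: "g \<in> C \<Longrightarrow> g \<in> G b"
proof -
  have "S - {s, t} \<subseteq> S - {excl b}" by auto
  then show "g \<in> C \<Longrightarrow> g \<in> G b" unfolding G_def C_def using gspan_mono by blast
qed

lemma G_sub: "g \<in> G b \<Longrightarrow> g \<in> gspan x S"
  using gspan_mono[of "S - {excl b}" S x] unfolding G_def by auto

lemma C_closed: "0 \<in> C" "g \<in> C \<Longrightarrow> h \<in> C \<Longrightarrow> g + h \<in> C" "g \<in> C \<Longrightarrow> - g \<in> C"
  unfolding C_def by (simp_all add: gspan_zero gspan_add gspan_uminus)

lemma G_closed: "0 \<in> G b" "g \<in> G b \<Longrightarrow> h \<in> G b \<Longrightarrow> g + h \<in> G b" "g \<in> G b \<Longrightarrow> - g \<in> G b"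
  unfolding G_def by (simp_all add: gspan_zero gspan_add gspan_uminus)

lemma C_uminus_iff [simp]: "- g \<in> C \<longleftrightarrow> g \<in> C"
  using C_closed(3)[of g] C_closed(3)[of "- g"] by auto

lemma C_add_right: "c \<in> C \<Longrightarrow> g + c \<in> C \<longleftrightarrow> g \<in> C"
  using C_closed(2)[of g c] C_closed(2)[of "g + c" "- c"] by auto

lemma C_add_left: "c \<in> C \<Longrightarrow> c + g \<in> C \<longleftrightarrow> g \<in> C"
  using C_closed(2)[of c g] C_closed(2)[of "- c" "c + g"] by auto

lemma gen_excl: "x (excl b) \<in> G (\<not> b)" "x (excl b) \<notin> C"
  using st unfolding G_def C_def by (auto simp: gn_in_gspan_iff)

text \<open>Van der Waerden's normal forms: lists of representatives of left cosets of \<open>C\<close> (last factor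
  first) coming alternately from the two factors, followed by an element of \<open>C\<close>.\<close>

definition crep where "crep g = (SOME r. - r + g \<in> C)"

lemma crep_in: "- crep g + g \<in> C"
  unfolding crep_def by (rule someI[of _ g]) (simp add: C_closed)

lemma crep_add: "c \<in> C \<Longrightarrow> crep (g + c) = crep g"
  unfolding crep_def by (simp add: C_add_right flip: add.assoc)

lemma crep_eq: "crep g = g + - (- crep g + g)"
  by (simp add: gsimps del: add_uminus_conv_diff)

lemma crep_G: "g \<in> G b \<Longrightarrow> crep g \<in> G b"
  using crep_eq[of g] G_closed C_sub_G[OF crep_in] by metis

lemma crep_C: "crep g \<in> C \<longleftrightarrow> g \<in> C"
  using C_add_right[of "- (- crep g + g)" g] crep_in[of g] C_uminus_iff crep_eq by metis

lemma crep_crep: "crep (crep g) = crep g"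
  using crep_add[of "- (- crep g + g)" g] crep_in[of g] C_uminus_iff crep_eq by metis

definition nh where "nh b rs \<longleftrightarrow> rs = [] \<or> hd rs \<notin> G b"

fun wf_nf where
  "wf_nf [] = True"
| "wf_nf (r # rs) = ((r \<in> G True \<or> r \<in> G False) \<and> r \<notin> C \<and> crep r = r \<and> wf_nf rs
     \<and> (\<forall>b. r \<in> G b \<longrightarrow> nh b rs))"

definition valid where "valid p \<longleftrightarrow> wf_nf (fst p) \<and> snd p \<in> C"

text \<open>\<open>fuse b\<close> and \<open>unfuse\<close> identify normal forms with pairs of a
  list satisfying \<open>nh b\<close> and an element of \<open>G b\<close>. On these pairs
  \<open>G b\<close> acts by right translation, which is how \<open>move\<close> is defined.\<close>

definition fuse where
  "fuse b p = (if nh b (fst p) then p else (tl (fst p), hd (fst p) + snd p))"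

definition unfuse where
  "unfuse p = (if snd p \<in> C then p else (crep (snd p) # fst p, - crep (snd p) + snd p))"

lemma fuse_props:
  assumes "valid p"
  shows "wf_nf (fst (fuse b p))" "nh b (fst (fuse b p))" "snd (fuse b p) \<in> G b" "unfuse (fuse b p) = p"
proof -
  obtain rs c where p: "p = (rs, c)" by force
  have c: "c \<in> C" and wf: "wf_nf rs" using assms by (auto simp: valid_def p)
  have "wf_nf (fst (fuse b p)) \<and> nh b (fst (fuse b p)) \<and> snd (fuse b p) \<in> G b \<and> unfuse (fuse b p) = p"
  proof (cases "nh b rs")
    case True
    then show ?thesis using c wf C_sub_G by (simp add: p fuse_def unfuse_def)
  next
    case False
    then obtain r rs' where rs: "rs = r # rs'" "r \<in> G b" by (cases rs) (auto simp: nh_def)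
    then show ?thesis
      using False c wf by (auto simp: p fuse_def unfuse_def C_add_right crep_add G_closed C_sub_G)
  qed
  then show "wf_nf (fst (fuse b p))" "nh b (fst (fuse b p))" "snd (fuse b p) \<in> G b" "unfuse (fuse b p) = p"
    by blast+
qed

lemma unfuse_props:
  assumes "wf_nf rs" "nh b rs" "g \<in> G b"
  shows "valid (unfuse (rs, g))" "fuse b (unfuse (rs, g)) = (rs, g)"
proof -
  have "nh b' rs" if "crep g \<in> G b'" "g \<notin> C" for b'
    using that assms crep_G[OF assms(3)] G_Int[of "crep g" b] crep_C[of g] by (cases "b' = b") auto
  moreover have "crep g \<in> G True \<or> crep g \<in> G False"
    using crep_G[OF assms(3)] by (cases b) auto
  ultimately show "valid (unfuse (rs, g))"
    using assms crep_in[of g] by (auto simp: valid_def unfuse_def crep_C crep_crep)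
  show "fuse b (unfuse (rs, g)) = (rs, g)"
    using assms crep_G[OF assms(3)] by (auto simp: fuse_def unfuse_def nh_def)
qed

definition move where
  "move b g p = (if valid p then unfuse (fst (fuse b p), snd (fuse b p) + g) else p)"

lemma move_valid: "g \<in> G b \<Longrightarrow> valid p \<Longrightarrow> valid (move b g p)"
  using fuse_props[of p b] unfuse_props(1) G_closed by (simp add: move_def)

lemma move_add:
  assumes "g \<in> G b" "h \<in> G b"
  shows "move b h (move b g p) = move b (g + h) p"
proof (cases "valid p")
  case True
  have "fuse b (move b g p) = (fst (fuse b p), snd (fuse b p) + g)"
    using fuse_props[OF True, of b] assms by (simp add: move_def True unfuse_props G_closed)
  then show ?thesis
    using move_valid[OF assms(1) True] unfolding move_def[of b h] move_def[of b "g + h"]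
    by (simp add: True add.assoc)
qed (simp add: move_def)

lemma move_zero: "move b 0 p = p"
  using fuse_props(4)[of p b] by (simp add: move_def)

text \<open>The result does not depend on b: on \<open>C\<close> the actions of the two factors
  coincide, so they can be glued.\<close>

lemma move_C:
  assumes "c \<in> C"
  shows "move b c p = (if valid p then (fst p, snd p + c) else p)"
proof (cases "valid p")
  case True
  obtain rs d where p: "p = (rs, d)" by force
  have d: "d \<in> C" and wf: "wf_nf rs" using True by (auto simp: valid_def p)
  show ?thesis
  proof (cases "nh b rs")
    case True
    then show ?thesis using assms d by (simp add: p move_def fuse_def unfuse_def C_closed)
  next
    case False
    then obtain r rs' where rs: "rs = r # rs'" "r \<in> G b" by (cases rs) (auto simp: nh_def)
    have "r \<notin> C" "crep r = r" using wf by (auto simp: rs)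
    moreover have "d + c \<in> C" using assms d by (simp add: C_closed)
    ultimately show ?thesis
      using False \<open>valid p\<close> by (simp add: p rs(1) move_def fuse_def unfuse_def add.assoc C_add_right crep_add)
  qed
qed (simp add: move_def)

definition mv where "mv b g = Sym (move b g)"

lemma app_mv: "g \<in> G b \<Longrightarrow> app (mv b g) = move b g"
  unfolding mv_def
  by (rule app_Sym, rule o_bij[of "move b (- g)"]) (auto simp: fun_eq_iff move_add G_closed move_zero)

lemma mv_add: "g \<in> G b \<Longrightarrow> h \<in> G b \<Longrightarrow> mv b (g + h) = mv b g + mv b h"
  by (rule symgrp_eqI) (simp add: app_mv move_add G_closed)

lemma mv_zero: "mv b 0 = 0"
  by (rule symgrp_eqI) (simp add: app_mv move_zero G_closed)

lemma mv_uminus: "g \<in> G b \<Longrightarrow> mv b (- g) = - mv b g"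
  using mv_add[of g b "- g"] by (metis G_closed(3) mv_zero add.right_inverse minus_unique)

definition letter where
  "letter u = (if u \<notin> S then 0 else if u = t then mv False (x u) else mv True (x u))"

lemma letter_eq:
  assumes "u \<in> S - {excl b}"
  shows "letter u = mv b (x u)" "x u \<in> G b"
proof -
  show "x u \<in> G b" using assms unfolding G_def by (intro gspan_gen)
  have "mv True (x u) = mv False (x u)" if "u \<in> S - {s, t}"
  proof -
    have "x u \<in> C" using that unfolding C_def by (intro gspan_gen)
    then have "move True (x u) = move False (x u)" by (simp add: move_C fun_eq_iff)
    then show ?thesis by (simp add: mv_def)
  qed
  then show "letter u = mv b (x u)" using assms by (cases b) (auto simp: letter_def)
qed

text \<open>Related letters are never the pair s, t, so both lie in one factor, where the relation
  already holds.\<close>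

lemma letter_ok: "arel_ok cm br iv letter"
proof -
  have pair: "\<exists>b. u \<in> S - {excl b} \<and> v \<in> S - {excl b}" if "cm u v \<or> br u v" for u v
  proof -
    have "u \<in> S" "v \<in> S" using that cm_S br_S cm_sym br_sym by blast+
    moreover have "\<not> (u = s \<and> v = t)" "\<not> (u = t \<and> v = s)"
      using that st cm_sym br_sym by blast+
    ultimately show ?thesis using st(3) by (cases "u = t \<or> v = t") (auto intro: exI[of _ False] exI[of _ True])
  qed
  have "letter u + letter v = letter v + letter u" if uv: "cm u v" for u v
  proof -
    obtain b where "u \<in> S - {excl b}" "v \<in> S - {excl b}" using pair uv by blast
    then show ?thesis using gn_commute[OF uv, of iv]
      by (simp add: letter_eq[of _ b] flip: mv_add)
  qed
  moreover have "letter u + letter v + letter u = letter v + letter u + letter v" if uv: "br u v" for u v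
  proof -
    obtain b where "u \<in> S - {excl b}" "v \<in> S - {excl b}" using pair uv by blast
    then show ?thesis using gn_braid[OF uv, of iv]
      by (simp add: letter_eq[of _ b] G_closed flip: mv_add)
  qed
  moreover have "letter u + letter u = 0" if iv for u
  proof (cases "u \<in> S")
    case True
    have "x u + x u = 0" using gn_ok[of iv] that unfolding arel_ok_def by blast
    moreover obtain b where "u \<in> S - {excl b}" using True st(3) by (cases "u = t") (auto intro: that[of False] that[of True])
    ultimately show ?thesis by (simp add: letter_eq[of _ b] mv_zero flip: mv_add)
  qed (simp add: letter_def)
  ultimately show ?thesis unfolding arel_ok_def by blast
qed

lemma ev_letter:
  assumes "w \<in> lists (Sigma (S - {excl b}) (\<lambda>_. UNIV))"
  shows "ev letter w = mv b (ev x w) \<and> ev x w \<in> G b"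
  using assms
proof (induction w)
  case (Cons l w)
  obtain u c where l: "l = (u, c)" by force
  show ?case using Cons letter_eq[of u b]
    by (auto simp: l mv_add G_closed mv_uminus)
qed (simp add: mv_zero G_closed)

section \<open>Alternating products in the amalgam\<close>

fun alt :: "bool \<Rightarrow> 'a word set symgrp list \<Rightarrow> bool" where
  "alt b [] = True"
| "alt b (g # gs) = (g \<in> G b \<and> g \<notin> C \<and> alt (\<not> b) gs)"

lemma alt_append: "alt b (gs @ hs) \<longleftrightarrow> alt b gs \<and> alt (b = even (length gs)) hs"
proof (induction gs arbitrary: b)
  case (Cons g gs)
  have "((\<not> b) = even (length gs)) = (b = even (length (g # gs)))" by (cases b) auto
  then show ?case using Cons[of "\<not> b"] by simp
qed simp

text \<open>Each factor adds exactly one representative, since the one it puts in front lies outside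
  the factor that acts next.\<close>

lemma alt_walk:
  assumes "alt b gs" "valid p" "nh b (fst p)"
  shows "\<exists>w. ev x w = sum_list gs \<and> length (fst (app (ev letter w) p)) = length (fst p) + length gs"
  using assms
proof (induction gs arbitrary: b p)
  case Nil
  then show ?case by (intro exI[of _ "[]"]) simp
next
  case (Cons g gs)
  have g: "g \<in> G b" "g \<notin> C" using Cons.prems by auto
  then obtain v where v: "v \<in> lists (Sigma (S - {excl b}) (\<lambda>_. UNIV))" "g = ev x v"
    unfolding G_def gspan_def by blast
  define p' where "p' = app (ev letter v) p"
  have p'm: "p' = move b g p" using ev_letter[OF v(1)] g(1) by (simp add: p'_def app_mv v(2))
  have c: "snd p \<in> C" using Cons.prems by (simp add: valid_def)
  have p': "p' = (crep (snd p + g) # fst p, - crep (snd p + g) + (snd p + g))"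
    using Cons.prems(2,3) c g(2) by (simp add: p'm move_def fuse_def unfuse_def C_add_left)
  have "crep (snd p + g) \<notin> G (\<not> b)"
    using G_Int[of "crep (snd p + g)" b] crep_G[of "snd p + g" b] g c
    by (auto simp: crep_C C_add_left G_closed C_sub_G)
  then have "nh (\<not> b) (fst p')" by (simp add: nh_def p')
  moreover have "valid p'" using move_valid[OF g(1) Cons.prems(2)] by (simp add: p'm)
  moreover have "alt (\<not> b) gs" using Cons.prems(1) by simp
  ultimately obtain w where w: "ev x w = sum_list gs"
    "length (fst (app (ev letter w) p')) = length (fst p') + length gs"
    using Cons.IH[of "\<not> b" p'] by blast
  show ?case using w v(2) by (intro exI[of _ "v @ w"]) (simp add: p'_def[symmetric] p')
qed

lemma alt_length_unique:
  assumes "alt b gs" "alt b' hs" "sum_list gs = sum_list hs"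
  shows "length gs = length hs"
proof -
  have "valid ([], 0)" by (simp add: valid_def C_closed)
  then obtain v w where "ev x v = sum_list gs" "length (fst (app (ev letter v) ([], 0))) = length gs"
    "ev x w = sum_list hs" "length (fst (app (ev letter w) ([], 0))) = length hs"
    using alt_walk[OF assms(1), of "([], 0)"] alt_walk[OF assms(2), of "([], 0)"]
    by (auto simp: nh_def)
  then show ?thesis using gn_universal[OF letter_ok, of v w] assms(3) by metis
qed

text \<open>A factor from the other side put in front gives an alternating product of length at
  least two; were the sum in \<open>C\<close>, the same element would be a single factor.\<close>

lemma alt_not_C:
  assumes "alt b gs" "gs \<noteq> []"
  shows "sum_list gs \<notin> C"
proof
  assume c: "sum_list gs \<in> C"
  have 1: "x (excl b) \<in> G (\<not> b)" "x (excl b) \<notin> C" by (rule gen_excl)+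
  have "alt (\<not> b) (x (excl b) # gs)" using assms 1 by simp
  moreover have "alt (\<not> b) [x (excl b) + sum_list gs]"
    using 1 c by (simp add: G_closed C_sub_G C_add_right)
  ultimately have "length (x (excl b) # gs) = length [x (excl b) + sum_list gs]"
    by (rule alt_length_unique) simp
  then show False using assms by simp
qed

lemma alt_exists:
  assumes "g \<in> gspan x S"
  shows "g \<in> C \<or> (\<exists>b gs. alt b gs \<and> gs \<noteq> [] \<and> sum_list gs = g)"
proof -
  obtain w where w: "w \<in> lists (Sigma S (\<lambda>_. UNIV))" "g = ev x w" using assms unfolding gspan_def by blast
  have "ev x w \<in> C \<or> (\<exists>b gs. alt b gs \<and> gs \<noteq> [] \<and> sum_list gs = ev x w)"
    using w(1)
  proof (induction w)
    case (Cons l w)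
    obtain u c where l: "l = (u, c)" by force
    define a where "a = (if c then x u else - x u)"
    obtain b' where "u \<in> S - {excl b'}"
      using Cons st(3) by (cases "u = t") (auto simp: l intro: that[of False] that[of True])
    then have a: "a \<in> G b'" using letter_eq(2)[of u b'] by (simp add: a_def G_closed)
    have ev: "ev x (l # w) = a + ev x w" by (simp add: l a_def)
    from Cons consider "ev x w \<in> C" | b h gs where "alt b (h # gs)" "h + sum_list gs = ev x w"
      by (metis list.exhaust sum_list.Cons)
    then show ?case
    proof cases
      case 1
      then have "a + ev x w \<in> G b'" using a by (simp add: G_closed C_sub_G)
      then show ?thesis unfolding ev by (cases "a + ev x w \<in> C") (auto intro!: exI[of _ b'] exI[of _ "[a + ev x w]"])
    next
      case 2
      show ?thesis
      proof (cases "a \<in> G b")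
        case ab: True
        show ?thesis
        proof (cases "a + h \<in> C")
          case True
          show ?thesis
          proof (cases gs)
            case Nil
            then show ?thesis using True 2 by (simp add: ev)
          next
            case (Cons k ks)
            then have "alt (\<not> b) ((a + h + k) # ks)" "sum_list ((a + h + k) # ks) = ev x (l # w)"
              using True 2 by (auto simp: ev G_closed C_sub_G C_add_left) (simp add: 2(2)[symmetric] add.assoc)
            then show ?thesis by blast
          qed
        next
          case False
          then have "alt b ((a + h) # gs)" "sum_list ((a + h) # gs) = ev x (l # w)"
            using ab 2 by (auto simp: ev add.assoc G_closed)
          then show ?thesis by blast
        qed
      next
        case False
        then have "a \<notin> C" using C_sub_G by blast
        moreover have "b' = (\<not> b)" using a False by (cases b; cases b') auto
        ultimately have "alt (\<not> b) (a # h # gs)" "sum_list (a # h # gs) = ev x (l # w)"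
          using a 2 by (auto simp: ev)
        then show ?thesis by blast
      qed
    qed
  qed (simp add: C_closed)
  then show ?thesis by (simp add: w(2))
qed

text \<open>The candidates are d, 2d and 3d. Their differences are not in \<open>C\<close>, so each
  of the two conditions involving a excludes at most one of them.\<close>

lemma avoid_cosets:
  assumes "a \<in> G b"
  obtains h where "h \<in> G b" "h \<notin> C" "h + a \<notin> C" "- h + a \<notin> C"
proof -
  let ?o = "excl (\<not> b)"
  obtain z where z: "z \<in> S" "z \<noteq> s" "z \<noteq> t" "\<not> cm ?o z" "\<not> br ?o z"
    using third by (cases b) auto
  define d where "d = x ?o + x z"
  have dG: "d \<in> G b" using z st unfolding d_def G_def by (auto intro!: gspan_add gspan_gen)
  have "ev x (concat (replicate p [(?o, True), (z, True)])) \<notin> C" if "p \<in> {1, 2, 3}" for p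
    unfolding C_def using z that by (intro infinite_order) auto
  from this[of 1] this[of 2] this[of 3]
  have d: "d \<notin> C" "d + d \<notin> C" "d + (d + d) \<notin> C"
    by (simp_all add: d_def numeral_eq_Suc add.assoc)
  have 1: "u - v \<in> C" if "u + a \<in> C" "v + a \<in> C" for u v
    using C_closed(2)[OF that(1) C_closed(3)[OF that(2)]] by (simp add: gsimps del: add_uminus_conv_diff)
  have 2: "- u + v \<in> C" if "- u + a \<in> C" "- v + a \<in> C" for u v
    using C_closed(2)[OF that(1) C_closed(3)[OF that(2)]] by (simp add: gsimps del: add_uminus_conv_diff)
  have "\<not> (d + a \<in> C \<and> d + d + a \<in> C)" "\<not> (d + a \<in> C \<and> d + (d + d) + a \<in> C)"
    "\<not> (d + d + a \<in> C \<and> d + (d + d) + a \<in> C)"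
    using 1[of "d + d" d] 1[of "d + (d + d)" d] 1[of "d + (d + d)" "d + d"] d
    by (auto simp: gsimps simp del: add_uminus_conv_diff)
  moreover have "\<not> (- d + a \<in> C \<and> - (d + d) + a \<in> C)" "\<not> (- d + a \<in> C \<and> - (d + (d + d)) + a \<in> C)"
    "\<not> (- (d + d) + a \<in> C \<and> - (d + (d + d)) + a \<in> C)"
    using 2[of d "d + d"] 2[of d "d + (d + d)"] 2[of "d + d" "d + (d + d)"] d
    by (auto simp: gsimps simp del: add_uminus_conv_diff)
  ultimately have "\<exists>h\<in>{d, d + d, d + (d + d)}. h + a \<notin> C \<and> - h + a \<notin> C"
    by blast
  then show thesis using that d dG G_closed(2) by blast
qed

theorem abelian_normal_in_C:
  assumes "N \<subseteq> gspan x S"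
    and conj: "\<And>a g. a \<in> gspan x S \<Longrightarrow> g \<in> N \<Longrightarrow> a + g - a \<in> N"
    and comm: "\<And>g h. g \<in> N \<Longrightarrow> h \<in> N \<Longrightarrow> g + h = h + g"
  shows "N \<subseteq> C"
proof (rule ccontr)
  assume "\<not> N \<subseteq> C"
  then obtain g where g: "g \<in> N" "g \<notin> C" by blast
  define P where "P k \<longleftrightarrow> (\<exists>b gs. alt b gs \<and> length gs = k \<and> gs \<noteq> [] \<and> sum_list gs \<in> N)" for k
  have "\<exists>k. P k" unfolding P_def using alt_exists[of g] g assms(1) by blast
  then have "P (LEAST k. P k)" by (rule LeastI_ex)
  then obtain b gs where gs: "alt b gs" "length gs = (LEAST k. P k)" "gs \<noteq> []" "sum_list gs \<in> N"
    unfolding P_def by blast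
  have least: "length gs \<le> length hs" if "alt b' hs" "hs \<noteq> []" "sum_list hs \<in> N" for b' hs
    unfolding gs(2) using that by (intro Least_le) (auto simp: P_def)
  obtain a ms where ams: "gs = a # ms" using gs(3) by (cases gs) auto
  have a: "a \<in> G b" "a \<notin> C" and altms: "alt (\<not> b) ms" using gs(1) by (auto simp: ams)
  show False
  proof (cases "ms = []")
    case True
    \<comment> \<open>The single factor a commutes with its conjugate by u from the other side, yet
      their commutator is an alternating product of eight factors.\<close>
    define u where "u = x (excl b)"
    have u: "u \<in> G (\<not> b)" "u \<notin> C" unfolding u_def by (rule gen_excl)+
    have aN: "a \<in> N" using gs(4) True by (simp add: ams)
    have "u + a - u \<in> N" using conj aN G_sub u(1) by blast
    from comm[OF aN this] have "sum_list [a, u, a, - u, - a, u, - a, - u] = 0"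
      by (simp add: gsimps del: add_uminus_conv_diff)
        (metis (no_types, opaque_lifting) add.assoc add.right_inverse minus_add minus_minus)
    moreover have "alt b [a, u, a, - u, - a, u, - a, - u]"
      using a u by (simp add: G_closed)
    ultimately show False using alt_not_C[of b] C_closed(1) by (metis list.distinct(1))
  next
    case False
    show False
    proof (cases "even (length gs)")
      case True
      \<comment> \<open>For even length k the end factors come from different sides. Conjugating by
        h changes the first factor and appends \<open>- h\<close>; multiplying this conjugate with
        the original in both orders gives alternating products of lengths 2k + 1 and 2k.\<close>
      obtain h where h: "h \<in> G b" "h \<notin> C" "h + a \<notin> C" "- h + a \<notin> C"
        using avoid_cosets[OF a(1)] .
      let ?g = "sum_list gs"
      have ev: "odd (length ms)" using True by (simp add: ams)
      have 1: "alt b ((h + a) # ms @ (- h + a) # ms)"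
        using h a altms ev by (simp add: alt_append G_closed)
      have 2: "alt b (gs @ (h + a) # ms @ [- h])"
        using h a altms ev gs(1) True by (simp add: alt_append G_closed)
      have "h + ?g - h \<in> N" using conj gs(4) G_sub h(1) by blast
      from comm[OF gs(4) this]
      have "sum_list (gs @ (h + a) # ms @ [- h]) = sum_list ((h + a) # ms @ (- h + a) # ms)"
        by (simp add: ams gsimps del: add_uminus_conv_diff)
      from alt_length_unique[OF 2 1 this] show False by (simp add: ams)
    next
      case odd: False
      obtain ks z where ms: "ms = ks @ [z]" using False by (cases ms rule: rev_cases) auto
      have ks: "even (length ks + 1)" using odd by (simp add: ams ms)
      have altks: "alt (\<not> b) ks" and z: "z \<in> G b" "z \<notin> C"
        using altms ks by (auto simp: ms alt_append)
      have ne: "ks \<noteq> []" using ks by auto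
      \<comment> \<open>For odd length the end factors come from the same side. Conjugating by
        \<open>- a\<close> merges them into z + a, or into the preceding factor if z + a lies in
        \<open>C\<close>, and the product gets shorter.\<close>
      have "- a + sum_list gs - (- a) \<in> N" using conj[of "- a"] gs(4) G_sub G_closed a(1) by blast
      then have N: "sum_list ks + (z + a) \<in> N" by (simp add: ams ms gsimps del: add_uminus_conv_diff)
      show False
      proof (cases "z + a \<in> C")
        case False
        then have "alt (\<not> b) (ks @ [z + a])" using altks ks z a by (simp add: alt_append G_closed)
        from least[OF this] N show False by (simp add: ams ms)
      next
        case True
        obtain js y where js: "ks = js @ [y]" using ne by (cases ks rule: rev_cases) auto
        have "alt (\<not> b) (js @ [y + (z + a)])"
          using altks True by (auto simp: js alt_append C_add_right G_closed C_sub_G)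
        from least[OF this] N show False by (simp add: ams ms js add.assoc)
      qed
    qed
  qed
qed

end

theorem (in coxeter_matrix) abelian_normal_trivial:
  assumes "finite S" and pairs: "\<And>s. s \<in> S \<Longrightarrow> \<exists>t. free_pair cm br S s t"
    and N: "N \<subseteq> gspan (gn iv) S"
      "\<And>a g. a \<in> gspan (gn iv) S \<Longrightarrow> g \<in> N \<Longrightarrow> a + g - a \<in> N"
      "\<And>g h. g \<in> N \<Longrightarrow> h \<in> N \<Longrightarrow> g + h = h + g"
  shows "N \<subseteq> {0}"
proof -
  have "N \<subseteq> gspan (gn iv) (S - F)" if "finite F" "F \<subseteq> S" for F
    using that
  proof (induction F rule: finite_induct)
    case empty
    then show ?case using N(1) by simp
  next
    case (insert s F)
    obtain t where "free_pair cm br S s t" using pairs insert.prems by blast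
    then interpret free_pair cm br S s t iv .
    have "N \<subseteq> gspan (gn iv) (S - {s, t})"
      using abelian_normal_in_C[OF N] unfolding C_def .
    moreover have "N \<subseteq> gspan (gn iv) (S - F)" using insert by simp
    ultimately have "N \<subseteq> gspan (gn iv) ((S - {s, t}) \<inter> (S - F))" using gspan_Int by blast
    moreover have "(S - {s, t}) \<inter> (S - F) \<subseteq> S - insert s F" by blast
    ultimately show ?case using gspan_mono by blast
  qed
  from this[of S] show ?thesis using assms(1) by (simp add: gspan_empty)
qed

section \<open>Virtual braid and twin groups as semidirect products\<close>

subsection \<open>Words in the adjacent transpositions\<close>

abbreviation tau :: "nat \<Rightarrow> nat \<Rightarrow> nat" where
  "tau i \<equiv> Transposition.transpose i (i + 1)"

lemma tau_braid: "tau i \<circ> (tau (i + 1) \<circ> tau i) = tau (i + 1) \<circ> (tau i \<circ> tau (i + 1))"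
  by (auto simp: fun_eq_iff Transposition.transpose_def)

lemma tau_far: "far i j \<Longrightarrow> tau i \<circ> tau j = tau j \<circ> tau i"
  by (auto simp: fun_eq_iff Transposition.transpose_def far_def)

definition pp :: "nat list \<Rightarrow> nat \<Rightarrow> nat" where
  "pp us = foldr (\<lambda>i p. tau i \<circ> p) us id"

lemma pp_simps [simp]: "pp [] = id" "pp (i # us) = tau i \<circ> pp us"
  by (simp_all add: pp_def)

lemma pp_append [simp]: "pp (us @ ws) = pp us \<circ> pp ws"
  by (induction us) auto

lemma pp_rev: "pp (rev us) \<circ> pp us = id"
  by (induction us) (auto simp: fun_eq_iff)

lemma pp_bij: "bij (pp us)"
  using pp_rev[of us] pp_rev[of "rev us"] by (intro o_bij[of "pp (rev us)"]) simp_all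

lemma pp_fix: "(\<And>k. k \<in> set us \<Longrightarrow> i \<noteq> k \<and> i \<noteq> Suc k) \<Longrightarrow> pp us i = i"
  by (induction us) (auto simp: Transposition.transpose_def)

lemma tau_permutes: "1 \<le> i \<Longrightarrow> i \<le> n - 1 \<Longrightarrow> tau i permutes {1..n}"
  by (rule permutes_swap_id) auto

lemma pp_permutes: "set us \<subseteq> {1..n - 1} \<Longrightarrow> pp us permutes {1..n}"
proof (induction us)
  case Nil
  then show ?case by (simp add: permutes_id id_def[symmetric])
next
  case (Cons i us)
  have "tau i permutes {1..n}" using Cons.prems by (intro tau_permutes) auto
  then show ?case unfolding pp_simps using Cons by (intro permutes_compose) auto
qed

text \<open>The word m, ..., j, empty for j = m + 1: coset representatives of the symmetric group on
  m points in that on m + 1 points.\<close>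

definition desc :: "nat \<Rightarrow> nat \<Rightarrow> nat list" where
  "desc m j = rev [j..<Suc m]"

lemma desc_snoc: "j \<le> m \<Longrightarrow> desc m j = desc m (Suc j) @ [j]"
  by (simp add: desc_def upt_conv_Cons del: upt_Suc)

lemma desc_Nil: "desc m (Suc m) = []"
  by (simp add: desc_def)

lemma set_desc: "set (desc m j) = {j..m}"
  by (auto simp: desc_def)

lemma pp_desc: "j \<le> Suc m \<Longrightarrow> pp (desc m j) j = Suc m"
proof (induction "Suc m - j" arbitrary: j)
  case 0
  then have "j = Suc m" by simp
  then show ?case by (simp add: desc_Nil)
next
  case (Suc d)
  then have "pp (desc m (Suc j)) (Suc j) = Suc m" "j \<le> m" by auto
  then show ?case by (simp add: desc_snoc)
qed

text \<open>Points are placed one at a time. The new value y is the image of some c beyond the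
  points already placed; precomposing with a descending word carries the next point to c and fixes
  the earlier ones.\<close>

lemma pp_transitive:
  assumes "distinct xs" "set xs \<subseteq> {1..n}"
  shows "\<exists>us. set us \<subseteq> {1..n - 1} \<and> (\<forall>i<length xs. pp us (Suc i) = xs ! i)"
  using assms
proof (induction xs rule: rev_induct)
  case Nil
  show ?case by (intro exI[of _ "[]"]) simp
next
  case (snoc y xs)
  then obtain us where us: "set us \<subseteq> {1..n - 1}" "\<And>i. i < length xs \<Longrightarrow> pp us (Suc i) = xs ! i"
    by auto
  have "y \<in> pp us ` {1..n}" using snoc.prems permutes_image[OF pp_permutes[OF us(1)]] by simp
  then obtain c where c: "c \<in> {1..n}" "pp us c = y" by blast
  have "length xs < c"
  proof (rule ccontr)
    assume "\<not> length xs < c"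
    then obtain i where "c = Suc i" "i < length xs" using c(1) by (cases c) auto
    then show False using us(2)[of i] c(2) snoc.prems(1) nth_mem[of i xs] by auto
  qed
  then have c': "Suc (length xs) \<le> Suc (c - 1)" "Suc (c - 1) = c" by auto
  let ?D = "desc (c - 1) (Suc (length xs))"
  have "pp ?D (Suc (length xs)) = c" using pp_desc[OF c'(1)] c'(2) by simp
  moreover have "pp ?D (Suc i) = Suc i" if "i < length xs" for i
    using that by (intro pp_fix) (auto simp: set_desc)
  moreover have "set ?D \<subseteq> {1..n - 1}" using c(1) by (auto simp: set_desc)
  ultimately show ?case
    using us c(2) by (intro exI[of _ "us @ ?D"]) (auto simp: nth_append less_Suc_eq)
qed

subsection \<open>The Artin-type group of arcs\<close>

definition arcs :: "nat \<Rightarrow> (nat \<times> nat) set" where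
  "arcs n = {(i, j). i \<in> {1..n} \<and> j \<in> {1..n} \<and> i \<noteq> j}"

definition cmn :: "nat \<Rightarrow> nat \<times> nat \<Rightarrow> nat \<times> nat \<Rightarrow> bool" where
  "cmn n = (\<lambda>(i, j) (k, l). (i, j) \<in> arcs n \<and> (k, l) \<in> arcs n \<and> i \<noteq> k \<and> i \<noteq> l \<and> j \<noteq> k \<and> j \<noteq> l)"

definition brn :: "bool \<Rightarrow> nat \<Rightarrow> nat \<times> nat \<Rightarrow> nat \<times> nat \<Rightarrow> bool" where
  "brn iv n = (\<lambda>(i, j) (k, l). \<not> iv \<and> (i, j) \<in> arcs n \<and> (k, l) \<in> arcs n
     \<and> (j = k \<and> i \<noteq> l \<or> i = l \<and> j \<noteq> k))"

lemma coxeter_matrix_arcs: "coxeter_matrix (cmn n) (brn iv n)"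
  by standard (auto simp: cmn_def brn_def arcs_def)

lemma finite_arcs: "finite (arcs n)"
  by (rule finite_subset[of _ "{1..n} \<times> {1..n}"]) (auto simp: arcs_def)

lemma free_pair_arcs:
  assumes "n \<ge> 3" "s \<in> arcs n"
  shows "\<exists>t. free_pair (cmn n) (brn iv n) (arcs n) s t"
proof -
  obtain i j where s: "s = (i, j)" by force
  have ij: "i \<in> {1..n}" "j \<in> {1..n}" "i \<noteq> j" using assms(2) by (auto simp: s arcs_def)
  have "\<exists>k\<in>{1, 2, 3}. k \<noteq> i \<and> k \<noteq> j" by auto
  then obtain k where "k \<in> {1, 2, 3}" and k: "k \<noteq> i" "k \<noteq> j" by blast
  then have "k \<in> {1..n}" using assms(1) by auto
  note k = this k
  interpret coxeter_matrix "cmn n" "brn iv n" by (rule coxeter_matrix_arcs)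
  \<comment> \<open>An arc with the same tail, ending at a third vertex k, is neither disjoint from
    nor consecutive to the given one; this provides \<open>third\<close>.\<close>
  have "free_pair (cmn n) (brn iv n) (arcs n) (i, j) (j, i)"
  proof
    show "\<exists>z\<in>arcs n. z \<noteq> (i, j) \<and> z \<noteq> (j, i) \<and> \<not> cmn n (i, j) z \<and> \<not> brn iv n (i, j) z"
      using ij k by (intro bexI[of _ "(i, k)"]) (auto simp: cmn_def brn_def arcs_def)
    show "\<exists>z\<in>arcs n. z \<noteq> (i, j) \<and> z \<noteq> (j, i) \<and> \<not> cmn n (j, i) z \<and> \<not> brn iv n (j, i) z"
      using ij k by (intro bexI[of _ "(j, k)"]) (auto simp: cmn_def brn_def arcs_def)
  qed (use ij in \<open>auto simp: cmn_def brn_def arcs_def\<close>)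
  then show ?thesis unfolding s by blast
qed

subsection \<open>Groups satisfying the virtual relations\<close>

text \<open>For twins, \<open>Sig\<close> and \<open>Vg\<close> play the roles of \<open>Tw\<close>
  and \<open>Rho\<close>, and \<open>iv\<close> exchanges the braid relation on \<open>Sig\<close>
  for squares. The group is abstract because both the presented group and the semidirect product
  satisfy these relations.\<close>

locale virtual_rels =
  fixes n :: nat and iv :: bool and e :: "vbgen \<Rightarrow> 'g::group_add"
  assumes n3: "n \<ge> 3"
    and v_sq: "1 \<le> i \<Longrightarrow> i \<le> n - 1 \<Longrightarrow> e (Vg i) + e (Vg i) = 0"
    and v_br: "1 \<le> i \<Longrightarrow> i + 1 \<le> n - 1 \<Longrightarrow>
      e (Vg i) + (e (Vg (i + 1)) + e (Vg i)) = e (Vg (i + 1)) + (e (Vg i) + e (Vg (i + 1)))"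
    and v_far: "1 \<le> i \<Longrightarrow> i \<le> n - 1 \<Longrightarrow> 1 \<le> j \<Longrightarrow> j \<le> n - 1 \<Longrightarrow> far i j \<Longrightarrow>
      e (Vg i) + e (Vg j) = e (Vg j) + e (Vg i)"
    and sv_far: "1 \<le> i \<Longrightarrow> i \<le> n - 1 \<Longrightarrow> 1 \<le> j \<Longrightarrow> j \<le> n - 1 \<Longrightarrow> far i j \<Longrightarrow>
      e (Sig i) + e (Vg j) = e (Vg j) + e (Sig i)"
    and s_far: "1 \<le> i \<Longrightarrow> i \<le> n - 1 \<Longrightarrow> 1 \<le> j \<Longrightarrow> j \<le> n - 1 \<Longrightarrow> far i j \<Longrightarrow>
      e (Sig i) + e (Sig j) = e (Sig j) + e (Sig i)"
    and mixed: "1 \<le> i \<Longrightarrow> i + 1 \<le> n - 1 \<Longrightarrow>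
      e (Vg i) + (e (Vg (i + 1)) + e (Sig i)) = e (Sig (i + 1)) + (e (Vg i) + e (Vg (i + 1)))"
    and s_br: "\<not> iv \<Longrightarrow> 1 \<le> i \<Longrightarrow> i + 1 \<le> n - 1 \<Longrightarrow>
      e (Sig i) + (e (Sig (i + 1)) + e (Sig i)) = e (Sig (i + 1)) + (e (Sig i) + e (Sig (i + 1)))"
    and s_sq: "iv \<Longrightarrow> 1 \<le> i \<Longrightarrow> i \<le> n - 1 \<Longrightarrow> e (Sig i) + e (Sig i) = 0"
begin

definition vv :: "nat list \<Rightarrow> 'g" where
  "vv us = sum_list (map (\<lambda>i. e (Vg i)) us)"

lemma vv_simps [simp]: "vv [] = 0" "vv (i # us) = e (Vg i) + vv us" "vv (us @ ws) = vv us + vv ws"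
  by (simp_all add: vv_def)

lemma minus_v: "1 \<le> i \<Longrightarrow> i \<le> n - 1 \<Longrightarrow> - e (Vg i) = e (Vg i)"
  using v_sq by (metis minus_unique)

lemma vv_rev: "set us \<subseteq> {1..n - 1} \<Longrightarrow> vv (rev us) = - vv us"
  by (induction us) (auto simp: minus_add minus_v)

text \<open>Moore's relations suffice to rewrite words in the transpositions, so words are compared both
  by their permutation and by their value in the group.\<close>

definition eqv :: "nat list \<Rightarrow> nat list \<Rightarrow> bool" where
  "eqv us ws \<longleftrightarrow> vv us = vv ws \<and> pp us = pp ws"

lemma eqv_refl: "eqv us us"
  and eqv_trans [trans]: "eqv us ws \<Longrightarrow> eqv ws zs \<Longrightarrow> eqv us zs"
  and eqv_append: "eqv us us' \<Longrightarrow> eqv ws ws' \<Longrightarrow> eqv (us @ ws) (us' @ ws')"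
  by (auto simp: eqv_def)

lemma eqv_sq: "1 \<le> i \<Longrightarrow> i \<le> n - 1 \<Longrightarrow> eqv [i, i] []"
  by (auto simp: eqv_def v_sq)

lemma eqv_braid: "1 \<le> i \<Longrightarrow> i + 1 \<le> n - 1 \<Longrightarrow> eqv [i + 1, i, i + 1] [i, i + 1, i]"
  using tau_braid[of i] v_br[of i] by (simp add: eqv_def)

lemma eqv_far:
  assumes "set us \<subseteq> {1..n - 1}" "1 \<le> k" "k \<le> n - 1" "\<And>i. i \<in> set us \<Longrightarrow> far i k"
  shows "eqv (us @ [k]) (k # us)"
  using assms
proof (induction us)
  case (Cons i us)
  have "eqv ([i] @ (us @ [k])) ([i] @ (k # us))"
    using Cons by (intro eqv_append eqv_refl) auto
  also have "eqv ([i, k] @ us) ([k, i] @ us)"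
    using Cons.prems v_far[of i k] tau_far[of i k] by (intro eqv_append eqv_refl) (auto simp: eqv_def)
  then have "eqv ([i] @ (k # us)) (k # i # us)" by simp
  finally show ?case by simp
qed (simp add: eqv_refl)

text \<open>Appended to the run m, ..., j, the letter k = j cancels, k = j - 1 extends the run, a
  smaller k commutes past it, and k > j emerges on the left as k - 1 by a braid relation.\<close>

lemma desc_step:
  assumes "1 \<le> j" "j \<le> Suc m" "1 \<le> k" "k \<le> m" "m \<le> n - 1"
  shows "\<exists>hs j'. set hs \<subseteq> {1..m - 1} \<and> 1 \<le> j' \<and> j' \<le> Suc m \<and> eqv (desc m j @ [k]) (hs @ desc m j')"
proof -
  consider "k = j" | "Suc k = j" | "Suc k < j" | "j < k" by linarith
  then show ?thesis
  proof cases
    case 1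
    have "eqv (desc m (Suc j) @ [j, j]) (desc m (Suc j) @ [])"
      using assms 1 by (intro eqv_append eqv_refl eqv_sq) auto
    then show ?thesis using assms 1 by (intro exI[of _ "[]"] exI[of _ "Suc j"]) (simp add: desc_snoc)
  next
    case 2
    then show ?thesis using assms
      by (intro exI[of _ "[]"] exI[of _ k]) (simp add: desc_snoc eqv_refl)
  next
    case 3
    have "eqv (desc m j @ [k]) (k # desc m j)"
      using assms 3 by (intro eqv_far) (auto simp: set_desc far_def)
    then show ?thesis using assms 3 by (intro exI[of _ "[k]"] exI[of _ j]) auto
  next
    case 4
    obtain l where l: "k = Suc l" using assms(3) by (cases k) auto
    have D: "desc m j = desc m (Suc k) @ [k, l] @ rev [j..<l]"
    proof -
      have "[j..<Suc m] = [j..<l] @ [l, k] @ [Suc k..<Suc m]"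
        using assms 4 l upt_add_eq_append[of j l "Suc m - l"]
        by (simp add: upt_conv_Cons[of l] upt_conv_Cons[of "Suc l"] del: upt_Suc)
      then show ?thesis by (simp add: desc_def del: upt_Suc)
    qed
    have "eqv (desc m (Suc k) @ [k, l] @ (rev [j..<l] @ [k])) (desc m (Suc k) @ [k, l] @ (k # rev [j..<l]))"
      using assms 4 l by (intro eqv_append eqv_refl eqv_far) (auto simp: far_def)
    also have "eqv (desc m (Suc k) @ [k, l, k] @ rev [j..<l]) (desc m (Suc k) @ [l, k, l] @ rev [j..<l])"
      using assms 4 l eqv_braid[of l] by (intro eqv_append eqv_refl) auto
    then have "eqv (desc m (Suc k) @ [k, l] @ (k # rev [j..<l])) (desc m (Suc k) @ [l, k, l] @ rev [j..<l])"
      by simp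
    also have "eqv ((desc m (Suc k) @ [l]) @ ([k, l] @ rev [j..<l])) ((l # desc m (Suc k)) @ ([k, l] @ rev [j..<l]))"
      using assms 4 l by (intro eqv_append eqv_refl eqv_far) (auto simp: far_def set_desc)
    then have "eqv (desc m (Suc k) @ [l, k, l] @ rev [j..<l]) ([l] @ desc m j)"
      by (simp add: D)
    finally have "eqv (desc m j @ [k]) ([l] @ desc m j)" by (simp add: D)
    then show ?thesis using assms 4 l by (intro exI[of _ "[l]"] exI[of _ j]) auto
  qed
qed

lemma desc_normal_form:
  assumes "set us \<subseteq> {1..m}" "m \<le> n - 1"
  shows "\<exists>hs j. set hs \<subseteq> {1..m - 1} \<and> 1 \<le> j \<and> j \<le> Suc m \<and> eqv us (hs @ desc m j)"
  using assms(1)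
proof (induction us rule: rev_induct)
  case Nil
  show ?case by (intro exI[of _ "[]"] exI[of _ "Suc m"]) (simp add: desc_Nil eqv_refl)
next
  case (snoc k us)
  then obtain hs j where h: "set hs \<subseteq> {1..m - 1}" "1 \<le> j" "j \<le> Suc m" "eqv us (hs @ desc m j)"
    by auto
  obtain hs' j' where h': "set hs' \<subseteq> {1..m - 1}" "1 \<le> j'" "j' \<le> Suc m"
    "eqv (desc m j @ [k]) (hs' @ desc m j')"
    using desc_step[of j m k] h snoc.prems assms(2) by auto
  have "eqv (us @ [k]) ((hs @ desc m j) @ [k])" using h(4) by (intro eqv_append eqv_refl)
  also have "eqv (hs @ (desc m j @ [k])) (hs @ (hs' @ desc m j'))" by (rule eqv_append[OF eqv_refl h'(4)])
  then have "eqv ((hs @ desc m j) @ [k]) ((hs @ hs') @ desc m j')" by simp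
  finally show ?case using h h' by (intro exI[of _ "hs @ hs'"] exI[of _ j']) auto
qed

text \<open>In the normal form \<open>hs @ desc m j\<close> the point j goes to m + 1. If j \<le> p
  is fixed, then j = m + 1 and the run is empty; otherwise the run uses only letters above p. For p
  = n no letter is left, which is Moore's theorem.\<close>

lemma stabilizer_word:
  assumes "set us \<subseteq> {1..m}" "m \<le> n - 1" "\<And>i. i \<in> {1..p} \<Longrightarrow> pp us i = i"
  shows "\<exists>ws. set ws \<subseteq> {Suc p..m} \<and> eqv us ws"
  using assms
proof (induction m arbitrary: us)
  case 0
  then show ?case by (intro exI[of _ "[]"]) (simp add: eqv_refl)
next
  case (Suc m)
  obtain hs j where h: "set hs \<subseteq> {1..m}" "1 \<le> j" "j \<le> Suc (Suc m)" "eqv us (hs @ desc (Suc m) j)"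
    using desc_normal_form[OF Suc.prems(1,2)] by auto
  have pus: "pp us = pp hs \<circ> pp (desc (Suc m) j)" using h(4) by (simp add: eqv_def)
  have "pp hs (Suc (Suc m)) = Suc (Suc m)" using h(1) by (intro pp_fix) auto
  then have usj: "pp us j = Suc (Suc m)" using pp_desc[OF h(3)] by (simp add: pus)
  have fix_hs: "pp hs i = i" if "i \<in> {1..p}" for i
  proof (cases "j \<le> p")
    case True
    then have "j = Suc (Suc m)" using Suc.prems(3)[of j] usj h(2) by auto
    then show ?thesis using Suc.prems(3)[OF that] by (simp add: pus desc_Nil)
  next
    case False
    then have "pp (desc (Suc m) j) i = i" using that by (intro pp_fix) (auto simp: set_desc)
    then show ?thesis using Suc.prems(3)[OF that] by (simp add: pus)
  qed
  obtain ws where ws: "set ws \<subseteq> {Suc p..m}" "eqv hs ws"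
    using Suc.IH[OF h(1)] Suc.prems(2) fix_hs by auto
  have "j = Suc (Suc m) \<or> p < j" using Suc.prems(3)[of j] usj h(2) by fastforce
  then have "set (desc (Suc m) j) \<subseteq> {Suc p..Suc m}" by (auto simp: set_desc)
  moreover have "eqv us (ws @ desc (Suc m) j)"
    using eqv_trans[OF h(4) eqv_append[OF ws(2) eqv_refl]] .
  ultimately show ?case using ws(1) by (intro exI[of _ "ws @ desc (Suc m) j"]) auto
qed

lemma vv_eq_zero:
  assumes "set us \<subseteq> {1..n - 1}" "pp us = id"
  shows "vv us = 0"
  using stabilizer_word[OF assms(1), of n] assms(2) by (auto simp: eqv_def)

lemma vv_commute_Sig:
  assumes "set us \<subseteq> {1..n - 1}" "pp us 1 = 1" "pp us 2 = 2"
  shows "vv us + e (Sig 1) = e (Sig 1) + vv us"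
proof -
  have "pp us i = i" if "i \<in> {1..2}" for i
    using that assms(2,3) by (cases "i = 1"; cases "i = 2") auto
  then obtain ws where ws: "set ws \<subseteq> {Suc 2..n - 1}" "vv us = vv ws"
    using stabilizer_word[OF assms(1), of 2] by (auto simp: eqv_def)
  have "vv ws + e (Sig 1) = e (Sig 1) + vv ws"
    using ws(1)
  proof (induction ws)
    case (Cons k ws)
    have "e (Sig 1) + e (Vg k) = e (Vg k) + e (Sig 1)"
      using Cons.prems by (intro sv_far) (auto simp: far_def)
    then show ?case using Cons by (simp add: add.assoc) (metis add.assoc)
  qed simp
  then show ?thesis by (simp add: ws(2))
qed

text \<open>Independence of the chosen word is \<open>arc_eq\<close>. The value 0 outside
  \<open>arcs n\<close> is compatible with the square relators, which range over all pairs.\<close>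

definition arc :: "nat \<times> nat \<Rightarrow> 'g" where
  "arc p = (if p \<in> arcs n then
     (let us = SOME us. set us \<subseteq> {1..n - 1} \<and> (pp us 1, pp us 2) = p in vv us + e (Sig 1) - vv us) else 0)"

lemma arc_exists:
  assumes "p \<in> arcs n"
  shows "\<exists>us. set us \<subseteq> {1..n - 1} \<and> (pp us 1, pp us 2) = p"
proof -
  obtain i j where p: "p = (i, j)" by force
  obtain us where us: "set us \<subseteq> {1..n - 1}" "\<And>k. k < 2 \<Longrightarrow> pp us (Suc k) = [i, j] ! k"
    using pp_transitive[of "[i, j]" n] assms by (auto simp: p arcs_def)
  from us(2)[of 0] us(2)[of 1] us(1) show ?thesis
    by (intro exI[of _ us]) (simp add: p numeral_2_eq_2)
qed

lemma pp_arcs: "set us \<subseteq> {1..n - 1} \<Longrightarrow> (i, j) \<in> arcs n \<Longrightarrow> (pp us i, pp us j) \<in> arcs n"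
  using pp_permutes[of us n] by (auto simp: arcs_def permutes_in_image bij_is_inj[OF pp_bij] inj_eq simp del: atLeastAtMost_iff)

text \<open>Two words with the same effect on 1 and 2 differ by one that fixes both points, and this
  commutes with \<open>Sig 1\<close>.\<close>

lemma arc_eq:
  assumes "set us \<subseteq> {1..n - 1}"
  shows "arc (pp us 1, pp us 2) = vv us + e (Sig 1) - vv us"
proof -
  let ?p = "(pp us 1, pp us 2)"
  have p: "?p \<in> arcs n" using assms n3 by (intro pp_arcs) (auto simp: arcs_def)
  define ws where "ws = (SOME ws. set ws \<subseteq> {1..n - 1} \<and> (pp ws 1, pp ws 2) = ?p)"
  have ws: "set ws \<subseteq> {1..n - 1}" "(pp ws 1, pp ws 2) = ?p"
    using someI_ex[OF arc_exists[OF p]] unfolding ws_def by blast+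
  have "pp (rev us) (pp us i) = i" for i using pp_rev[of us] by (simp add: fun_eq_iff)
  then have "vv (rev us @ ws) + e (Sig 1) = e (Sig 1) + vv (rev us @ ws)"
    using assms ws by (intro vv_commute_Sig) auto
  then have "- vv us + (vv ws + e (Sig 1)) = e (Sig 1) + (- vv us + vv ws)"
    using assms by (simp add: vv_rev add.assoc)
  then have "vv us + (- vv us + (vv ws + e (Sig 1))) - vv ws = vv us + (e (Sig 1) + (- vv us + vv ws)) - vv ws"
    by simp
  then have "vv ws + e (Sig 1) - vv ws = vv us + e (Sig 1) - vv us"
    by (simp add: gsimps del: add_uminus_conv_diff)
  moreover have "arc ?p = vv ws + e (Sig 1) - vv ws"
    using p by (simp only: arc_def Let_def ws_def[symmetric] if_True)
  ultimately show ?thesis by simp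
qed

lemma arc_conj:
  assumes "set us \<subseteq> {1..n - 1}" "(i, j) \<in> arcs n"
  shows "vv us + arc (i, j) - vv us = arc (pp us i, pp us j)"
proof -
  obtain ws where ws: "set ws \<subseteq> {1..n - 1}" "pp ws 1 = i" "pp ws 2 = j"
    using arc_exists[OF assms(2)] by auto
  show ?thesis
    using arc_eq[OF ws(1)] arc_eq[of "us @ ws"] assms(1) ws
    by (simp add: gsimps del: add_uminus_conv_diff)
qed

lemma arc_Sig: "1 \<le> i \<Longrightarrow> i \<le> n - 1 \<Longrightarrow> arc (i, i + 1) = e (Sig i)"
proof (induction i rule: nat_induct_at_least)
  case base
  then show ?case using arc_eq[of "[]"] by (simp add: numeral_2_eq_2)
next
  case (Suc i)
  have "vv [i, i + 1] + arc (i, i + 1) - vv [i, i + 1] = arc (pp [i, i + 1] i, pp [i, i + 1] (i + 1))"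
    using Suc by (intro arc_conj) (auto simp: arcs_def)
  moreover have "pp [i, i + 1] i = i + 1" "pp [i, i + 1] (i + 1) = i + 2"
    by (auto simp: Transposition.transpose_def)
  moreover have "vv [i, i + 1] + arc (i, i + 1) - vv [i, i + 1] = e (Sig (i + 1))"
    using Suc mixed[of i] by (simp add: gsimps del: add_uminus_conv_diff)
  ultimately show ?case by simp
qed

text \<open>By transitivity on tuples of distinct points every relation is conjugate to a standard
  one: between \<open>Sig 1\<close> and \<open>Sig 3\<close>, between \<open>Sig 1\<close> and
  \<open>Sig 2\<close>, or the square of \<open>Sig 1\<close>.\<close>

lemma arc_ok: "arel_ok (cmn n) (brn iv n) iv arc"
proof -
  have conj: "arc (pp us i, pp us (i + 1)) = vv us + e (Sig i) - vv us"
    if "set us \<subseteq> {1..n - 1}" "1 \<le> i" "i \<le> n - 1" for us i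
  proof -
    have "(i, i + 1) \<in> arcs n" using that by (auto simp: arcs_def)
    from arc_conj[OF that(1) this] show ?thesis using arc_Sig[OF that(2,3)] by simp
  qed
  have cm: "arc s + arc t = arc t + arc s" if "cmn n s t" for s t
  proof -
    obtain i j k l where st: "s = (i, j)" "t = (k, l)" by force
    have d: "distinct [i, j, k, l]" "set [i, j, k, l] \<subseteq> {1..n}"
      using that by (auto simp: st cmn_def arcs_def)
    then obtain us where us: "set us \<subseteq> {1..n - 1}" "\<And>m. m < 4 \<Longrightarrow> pp us (Suc m) = [i, j, k, l] ! m"
      using pp_transitive[OF d] by auto
    \<comment> \<open>Four distinct points force n \<ge> 4, so \<open>Sig 3\<close> is among the
      generators.\<close>
    have n4: "3 \<le> n - 1" using card_mono[OF _ d(2)] distinct_card[OF d(1)] by simp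
    have "s = (pp us 1, pp us (1 + 1))" "t = (pp us 3, pp us (3 + 1))"
      using us(2)[of 0] us(2)[of 1] us(2)[of 2] us(2)[of 3] by (simp_all add: st numeral_eq_Suc)
    moreover have "e (Sig 1) + e (Sig 3) = e (Sig 3) + e (Sig 1)"
      using n4 by (intro s_far) (auto simp: far_def)
    then have "e (Sig 1) + (e (Sig 3) + y) = e (Sig 3) + (e (Sig 1) + y)" for y
      by (simp only: add.assoc[symmetric])
    ultimately show ?thesis
      using conj[OF us(1), of 1] conj[OF us(1), of 3] n4
      by (simp add: gsimps del: add_uminus_conv_diff)
  qed
  have br: "arc (i, j) + arc (j, l) + arc (i, j) = arc (j, l) + arc (i, j) + arc (j, l)"
    if "\<not> iv" "(i, j) \<in> arcs n" "(j, l) \<in> arcs n" "i \<noteq> l" for i j l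
  proof -
    have d: "distinct [i, j, l]" "set [i, j, l] \<subseteq> {1..n}" using that by (auto simp: arcs_def)
    then obtain us where us: "set us \<subseteq> {1..n - 1}" "\<And>m. m < 3 \<Longrightarrow> pp us (Suc m) = [i, j, l] ! m"
      using pp_transitive[OF d] by auto
    have "(i, j) = (pp us 1, pp us (1 + 1))" "(j, l) = (pp us 2, pp us (2 + 1))"
      using us(2)[of 0] us(2)[of 1] us(2)[of 2] by (simp_all add: numeral_eq_Suc)
    moreover have "e (Sig 1) + (e (Sig 2) + e (Sig 1)) = e (Sig 2) + (e (Sig 1) + e (Sig 2))"
      using s_br[OF that(1), of 1] n3 by (simp add: numeral_2_eq_2)
    then have "e (Sig 1) + (e (Sig 2) + (e (Sig 1) + y)) = e (Sig 2) + (e (Sig 1) + (e (Sig 2) + y))" for y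
      by (simp only: add.assoc[symmetric])
    ultimately show ?thesis
      using conj[OF us(1), of 1] conj[OF us(1), of 2] n3
      by (simp add: gsimps del: add_uminus_conv_diff)
  qed
  have "arc s + arc t + arc s = arc t + arc s + arc t" if "brn iv n s t" for s t
    using that by (cases s; cases t) (auto simp: brn_def intro: br br[symmetric])
  moreover have "arc s + arc s = 0" if iv for s
  proof (cases "s \<in> arcs n")
    case True
    then obtain us where "set us \<subseteq> {1..n - 1}" "(pp us 1, pp us 2) = s" using arc_exists by blast
    then have "arc s = vv us + e (Sig 1) - vv us" using arc_eq by blast
    moreover have "e (Sig 1) + (e (Sig 1) + y) = y" for y
      using s_sq[OF that, of 1] n3 by (simp flip: add.assoc)
    ultimately show ?thesis by (simp add: gsimps del: add_uminus_conv_diff)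
  qed (simp add: arc_def)
  ultimately show ?thesis using cm unfolding arel_ok_def by blast
qed

end

subsection \<open>Rewriting into the arc group\<close>

text \<open>Reidemeister-Schreier rewriting: p is the permutation read so far, \<open>Vg\<close>
  letters only update it, and \<open>Sig i\<close> becomes an arc.\<close>

fun aw :: "(nat \<Rightarrow> nat) \<Rightarrow> vbgen word \<Rightarrow> (nat \<times> nat) word" where
  "aw p [] = []"
| "aw p ((Sig i, b) # w) = ((p i, p (i + 1)), b) # aw p w"
| "aw p ((Vg i, b) # w) = aw (p \<circ> tau i) w"

fun vp :: "vbgen word \<Rightarrow> nat list" where
  "vp [] = []"
| "vp ((Sig i, b) # w) = vp w"
| "vp ((Vg i, b) # w) = i # vp w"

lemma vp_append: "vp (u @ w) = vp u @ vp w"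
  by (induction u rule: vp.induct) auto

lemma aw_append: "aw p (u @ w) = aw p u @ aw (p \<circ> pp (vp u)) w"
  by (induction u arbitrary: p rule: vp.induct) (auto simp: comp_assoc)

lemma weval_simps:
  "weval f [] = id"
  "weval f ((g, b) # w) = (if b then f g else Hilbert_Choice.inv (f g)) \<circ> weval f w"
  by (simp_all add: weval_def)

lemma weval_piK: "weval piK_gen w = pp (vp w)"
  by (induction w rule: vp.induct) (auto simp: weval_simps fun_eq_iff)

lemma vp_winv: "vp (winv w) = rev (vp w)"
  by (induction w rule: vp.induct) (auto simp: vp_append)

abbreviation vwords :: "nat \<Rightarrow> vbgen word set" where
  "vwords n \<equiv> lists (Sigma (VB_gens n) (\<lambda>_. UNIV))"

lemma VB_gens_simps [simp]:
  "Sig i \<in> VB_gens n \<longleftrightarrow> 1 \<le> i \<and> i \<le> n - 1" "Vg i \<in> VB_gens n \<longleftrightarrow> 1 \<le> i \<and> i \<le> n - 1"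
  by (auto simp: VB_gens_def)

lemma vp_set: "w \<in> vwords n \<Longrightarrow> set (vp w) \<subseteq> {1..n - 1}"
  by (induction w rule: vp.induct) auto

lemma permutes_arcs: "p permutes {1..n} \<Longrightarrow> (i, j) \<in> arcs n \<Longrightarrow> (p i, p j) \<in> arcs n"
  using permutes_in_image[of p "{1..n}"] permutes_inj[of p "{1..n}"] by (auto simp: arcs_def inj_eq)

lemma permutes_arcs_Suc:
  "p permutes {1..n} \<Longrightarrow> 1 \<le> i \<Longrightarrow> i \<le> n - 1 \<Longrightarrow> (p i, p (i + 1)) \<in> arcs n"
  by (rule permutes_arcs) (auto simp: arcs_def)

lemma permutes_tau_iff:
  assumes "1 \<le> i" "i \<le> n - 1"
  shows "p \<circ> tau i permutes {1..n} \<longleftrightarrow> p permutes {1..n}"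
proof
  assume "p \<circ> tau i permutes {1..n}"
  then have "p \<circ> tau i \<circ> tau i permutes {1..n}" by (rule permutes_compose[OF tau_permutes[OF assms]])
  then show "p permutes {1..n}" by (simp add: comp_assoc)
qed (use tau_permutes[OF assms] in \<open>auto intro: permutes_compose\<close>)

lemma aw_lists:
  assumes "w \<in> vwords n" "p permutes {1..n}"
  shows "aw p w \<in> lists (Sigma (arcs n) (\<lambda>_. UNIV))"
  using assms
proof (induction w arbitrary: p rule: vp.induct)
  case (2 i b w)
  have "(p i, p (i + 1)) \<in> arcs n" using "2.prems" by (intro permutes_arcs_Suc) auto
  then show ?case using 2 by simp
next
  case (3 i b w)
  then show ?case using permutes_tau_iff[of i n p] by simp
qed simp

definition xg :: "bool \<Rightarrow> nat \<Rightarrow> nat \<times> nat \<Rightarrow> (nat \<times> nat) word set symgrp" where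
  "xg iv n = canon (arels (cmn n) (brn iv n) iv)"

lemma xg_ok: "arel_ok (cmn n) (brn iv n) iv (xg iv n)"
  by (simp add: arel_ok_iff xg_def canon_rel)

lemma xg_universal: "arel_ok (cmn n) (brn iv n) iv f \<Longrightarrow> ev (xg iv n) u = ev (xg iv n) w \<Longrightarrow> ev f u = ev f w"
  unfolding arel_ok_iff xg_def by (rule ev_canon_universal) auto

text \<open>The semidirect product of the arc group with the symmetric group, acting on itself from the right.\<close>

fun phi_step :: "bool \<Rightarrow> nat \<Rightarrow> vbgen \<Rightarrow> (nat \<times> nat) word set symgrp \<times> (nat \<Rightarrow> nat)
    \<Rightarrow> (nat \<times> nat) word set symgrp \<times> (nat \<Rightarrow> nat)" where
  "phi_step iv n (Sig i) (a, p) =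
     (if p permutes {1..n} \<and> 1 \<le> i \<and> i \<le> n - 1 then a + xg iv n (p i, p (i + 1)) else a, p)"
| "phi_step iv n (Vg i) (a, p) = (a, p \<circ> tau i)"

definition phi :: "bool \<Rightarrow> nat \<Rightarrow> vbgen \<Rightarrow> ((nat \<times> nat) word set symgrp \<times> (nat \<Rightarrow> nat)) symgrp" where
  "phi iv n g = Sym (phi_step iv n g)"

lemma app_phi_Vg: "app (phi iv n (Vg i)) = phi_step iv n (Vg i)" "- phi iv n (Vg i) = phi iv n (Vg i)"
proof -
  have *: "phi_step iv n (Vg i) (phi_step iv n (Vg i) z) = z" for z
    by (cases z) (simp add: comp_assoc)
  show "app (phi iv n (Vg i)) = phi_step iv n (Vg i)"
    unfolding phi_def using * by (rule involution_app)
  have "phi iv n (Vg i) + phi iv n (Vg i) = 0"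
    unfolding phi_def using * by (rule involution_app)
  then show "- phi iv n (Vg i) = phi iv n (Vg i)" by (rule minus_unique)
qed

lemma app_phi_Sig:
  "app (phi iv n (Sig i)) = phi_step iv n (Sig i)"
  "app (- phi iv n (Sig i)) (a, p) =
     (if p permutes {1..n} \<and> 1 \<le> i \<and> i \<le> n - 1 then a - xg iv n (p i, p (i + 1)) else a, p)"
proof -
  define g where "g = (\<lambda>(a, p). (if p permutes {1..n} \<and> 1 \<le> i \<and> i \<le> n - 1
    then a - xg iv n (p i, p (i + 1)) else a, p))"
  have *: "g (phi_step iv n (Sig i) z) = z" "phi_step iv n (Sig i) (g z) = z" for z
    by (cases z; simp add: g_def)+
  then have "bij (phi_step iv n (Sig i))" by (intro o_bij[of g]) (auto simp: fun_eq_iff)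
  then show 1: "app (phi iv n (Sig i)) = phi_step iv n (Sig i)" by (simp add: phi_def app_Sym)
  have "app (- phi iv n (Sig i)) = g" unfolding app_uminus 1 using * by (intro inv_equality) auto
  then show "app (- phi iv n (Sig i)) (a, p) =
     (if p permutes {1..n} \<and> 1 \<le> i \<and> i \<le> n - 1 then a - xg iv n (p i, p (i + 1)) else a, p)"
    by (simp add: g_def)
qed

text \<open>This makes the semidirect product an image of the presented group, so that equalities in
  the latter can be read off in the arc group.\<close>

lemma phi_virtual_rels:
  assumes "n \<ge> 3"
  shows "virtual_rels n iv (phi iv n)"
proof
  have ok: "\<And>s t. cmn n s t \<Longrightarrow> xg iv n s + xg iv n t = xg iv n t + xg iv n s"
    "\<And>s t. brn iv n s t \<Longrightarrow> xg iv n s + xg iv n t + xg iv n s = xg iv n t + xg iv n s + xg iv n t"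
    "\<And>s. iv \<Longrightarrow> xg iv n s + xg iv n s = 0"
    using xg_ok[of n iv] unfolding arel_ok_def by blast+
  fix i
  show "phi iv n (Vg i) + phi iv n (Vg i) = 0"
    by (metis app_phi_Vg(2) add.left_inverse)
  show "phi iv n (Vg i) + (phi iv n (Vg (i + 1)) + phi iv n (Vg i))
      = phi iv n (Vg (i + 1)) + (phi iv n (Vg i) + phi iv n (Vg (i + 1)))"
    using tau_braid[of i] by (intro symgrp_eqI) (auto simp: app_phi_Vg comp_assoc)
  {
    fix j assume ij: "1 \<le> i" "i \<le> n - 1" "1 \<le> j" "j \<le> n - 1" "far i j"
    show "phi iv n (Vg i) + phi iv n (Vg j) = phi iv n (Vg j) + phi iv n (Vg i)"
      using tau_far[OF ij(5)] by (intro symgrp_eqI) (auto simp: app_phi_Vg comp_assoc)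
    have "tau j i = i" "tau j (i + 1) = i + 1"
      using ij(5) by (auto simp: far_def Transposition.transpose_def)
    then show "phi iv n (Sig i) + phi iv n (Vg j) = phi iv n (Vg j) + phi iv n (Sig i)"
      using permutes_tau_iff[OF ij(3,4)] by (intro symgrp_eqI) (auto simp: app_phi_Vg app_phi_Sig)
    show "phi iv n (Sig i) + phi iv n (Sig j) = phi iv n (Sig j) + phi iv n (Sig i)"
    proof (rule symgrp_eqI)
      fix z :: "(nat \<times> nat) word set symgrp \<times> (nat \<Rightarrow> nat)"
      obtain a p where z: "z = (a, p)" by force
      have "xg iv n (p i, p (i + 1)) + xg iv n (p j, p (j + 1)) = xg iv n (p j, p (j + 1)) + xg iv n (p i, p (i + 1))"
        if p: "p permutes {1..n}"
      proof (rule ok(1))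
        have "(p i, p (i + 1)) \<in> arcs n" "(p j, p (j + 1)) \<in> arcs n"
          using ij p by (intro permutes_arcs_Suc; simp)+
        then show "cmn n (p i, p (i + 1)) (p j, p (j + 1))"
          using ij(5) permutes_inj[OF p] by (auto simp: cmn_def far_def inj_eq)
      qed
      then show "app (phi iv n (Sig i) + phi iv n (Sig j)) z = app (phi iv n (Sig j) + phi iv n (Sig i)) z"
        using ij by (simp add: z app_phi_Sig add.assoc)
    qed
  }
  {
    assume i: "1 \<le> i" "i + 1 \<le> n - 1"
    have tt: "tau i (tau (i + 1) i) = i + 1" "tau i (tau (i + 1) (i + 1)) = i + 2"
      by (auto simp: Transposition.transpose_def)
    show "phi iv n (Vg i) + (phi iv n (Vg (i + 1)) + phi iv n (Sig i))
      = phi iv n (Sig (i + 1)) + (phi iv n (Vg i) + phi iv n (Vg (i + 1)))"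
    proof (rule symgrp_eqI)
      fix z :: "(nat \<times> nat) word set symgrp \<times> (nat \<Rightarrow> nat)"
      obtain a p where z: "z = (a, p)" by force
      have "p \<circ> tau i \<circ> tau (i + 1) permutes {1..n} \<longleftrightarrow> p permutes {1..n}"
        using permutes_tau_iff[of i n p] permutes_tau_iff[of "i + 1" n "p \<circ> tau i"] i by simp
      then show "app (phi iv n (Vg i) + (phi iv n (Vg (i + 1)) + phi iv n (Sig i))) z
        = app (phi iv n (Sig (i + 1)) + (phi iv n (Vg i) + phi iv n (Vg (i + 1)))) z"
        using i tt by (simp add: z app_phi_Sig app_phi_Vg)
    qed
    assume "\<not> iv"
    show "phi iv n (Sig i) + (phi iv n (Sig (i + 1)) + phi iv n (Sig i))
      = phi iv n (Sig (i + 1)) + (phi iv n (Sig i) + phi iv n (Sig (i + 1)))"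
    proof (rule symgrp_eqI)
      fix z :: "(nat \<times> nat) word set symgrp \<times> (nat \<Rightarrow> nat)"
      obtain a p where z: "z = (a, p)" by force
      let ?s = "(p i, p (i + 1))" and ?t = "(p (i + 1), p (i + 1 + 1))"
      have "xg iv n ?s + xg iv n ?t + xg iv n ?s = xg iv n ?t + xg iv n ?s + xg iv n ?t"
        if p: "p permutes {1..n}"
      proof (rule ok(2))
        have "?s \<in> arcs n" "?t \<in> arcs n"
          using i p by (intro permutes_arcs_Suc; simp)+
        then show "brn iv n ?s ?t"
          using \<open>\<not> iv\<close> permutes_inj[OF p] by (auto simp: brn_def inj_eq)
      qed
      then show "app (phi iv n (Sig i) + (phi iv n (Sig (i + 1)) + phi iv n (Sig i))) z
        = app (phi iv n (Sig (i + 1)) + (phi iv n (Sig i) + phi iv n (Sig (i + 1)))) z"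
        using i by (simp add: z app_phi_Sig add.assoc)
    qed
  }
  show "phi iv n (Sig i) + phi iv n (Sig i) = 0" if iv
    using ok(3)[OF that] by (intro symgrp_eqI) (auto simp: app_phi_Sig add.assoc)
qed (use assms in auto)

lemma phi_walk:
  assumes "w \<in> vwords n" "p permutes {1..n}"
  shows "app (ev (phi iv n) w) (a, p) = (a + ev (xg iv n) (aw p w), p \<circ> pp (vp w))"
  using assms
proof (induction w arbitrary: a p rule: vp.induct)
  case (2 i b w)
  then show ?case by (auto simp: app_phi_Sig add.assoc gsimps simp del: add_uminus_conv_diff)
next
  case (3 i b w)
  then show ?case using permutes_tau_iff[of i n p] by (auto simp: app_phi_Vg comp_assoc)
qed simp

text \<open>Stated for arbitrary words because a class also contains words with letters outside the
  generators, and the witness in \<open>pkernel\<close> may be one of them.\<close>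

lemma phi_perm: "snd (app (ev (phi iv n) w) (a, p)) = p \<circ> weval piK_gen w"
proof (induction w arbitrary: a p)
  case (Cons l w)
  obtain g b where l: "l = (g, b)" by force
  show ?case using Cons by (cases g) (auto simp: l app_phi_Sig app_phi_Vg weval_simps comp_assoc)
qed (simp add: weval_simps)

context virtual_rels
begin

section \<open>Pure words as words in the arcs\<close>

lemma rewrite:
  assumes "set us \<subseteq> {1..n - 1}" "w \<in> vwords n"
  shows "vv us + ev e w = ev arc (aw (pp us) w) + vv (us @ vp w)"
  using assms
proof (induction w arbitrary: us rule: vp.induct)
  case (2 i b w)
  have i: "1 \<le> i" "i \<le> n - 1" using "2.prems" by auto
  have "(i, i + 1) \<in> arcs n" using i by (auto simp: arcs_def)
  from arc_conj[OF "2.prems"(1) this]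
  have *: "arc (pp us i, pp us (i + 1)) = vv us + e (Sig i) - vv us" using arc_Sig[OF i] by simp
  have "vv us + ev e w = ev arc (aw (pp us) w) + vv (us @ vp w)" using 2 by auto
  then have "ev e w = - vv us + (ev arc (aw (pp us) w) + vv (us @ vp w))"
    by (metis minus_add_cancel)
  then show ?case using * by (simp add: gsimps del: add_uminus_conv_diff)
next
  case (3 i b w)
  have i: "1 \<le> i" "i \<le> n - 1" using "3.prems" by auto
  have "vv (us @ [i]) + ev e w = ev arc (aw (pp (us @ [i])) w) + vv ((us @ [i]) @ vp w)"
    using 3 by (intro "3.IH") auto
  then show ?case using minus_v[OF i] by (simp add: add.assoc)
qed simp

lemma rewrite_pure:
  assumes "w \<in> vwords n" "pp (vp w) = id"
  shows "ev e w = ev arc (aw id w)"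
  using rewrite[of "[]" w] vv_eq_zero[OF vp_set[OF assms(1)] assms(2)] assms(1) by simp

text \<open>An arc lifts to the conjugate of \<open>Sig 1\<close> by a word carrying 1, 2 to its
  ends. The starting permutation p is left free because a lift is later placed behind a word that is
  not pure.\<close>

lemma lift_arc_word:
  assumes "u \<in> lists (Sigma (arcs n) (\<lambda>_. UNIV))"
  shows "\<exists>w\<in>vwords n. pp (vp w) = id \<and> (\<forall>p. aw p w = map (\<lambda>((i, j), b). ((p i, p j), b)) u)"
  using assms
proof (induction u)
  case Nil
  show ?case by (intro bexI[of _ "[]"]) auto
next
  case (Cons l u)
  obtain q b where l: "l = (q, b)" by (cases l)
  obtain w where w: "w \<in> vwords n" "pp (vp w) = id"
    "\<And>p. aw p w = map (\<lambda>((i, j), b). ((p i, p j), b)) u" using Cons.IH by blast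
  obtain us where us: "set us \<subseteq> {1..n - 1}" "(pp us 1, pp us 2) = q"
    using arc_exists[of q] Cons by (auto simp: l)
  let ?V = "\<lambda>us. map (\<lambda>i. (Vg i, True)) us"
  have V: "vp (?V us) = us" "aw p (?V us) = []" "set us \<subseteq> {1..n - 1} \<longleftrightarrow> ?V us \<in> vwords n" for us p
    by (induction us arbitrary: p) auto
  let ?w = "?V us @ [(Sig 1, b)] @ ?V (rev us) @ w"
  have id: "pp us \<circ> pp (rev us) = id" using pp_rev[of "rev us"] by simp
  have "?w \<in> vwords n" using us(1) V(3)[of us] V(3)[of "rev us"] w(1) n3 by simp
  moreover have "pp (vp ?w) = id" using w(2) id by (simp add: vp_append V)
  moreover have "aw p ?w = map (\<lambda>((i, j), b). ((p i, p j), b)) (l # u)" for p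
  proof -
    have "aw p ?w = ((p (pp us 1), p (pp us 2)), b) # aw (p \<circ> (pp us \<circ> pp (rev us))) w"
      by (simp add: aw_append V vp_append numeral_2_eq_2 comp_assoc)
    then show ?thesis using us(2) w(3) by (simp add: id l) auto
  qed
  ultimately show ?case by blast
qed

text \<open>Pure words with value in N are rewritten to a set M in the arc group. Conjugates stay in
  M since arc words lift to pure words, \<open>complete\<close> makes M commutative, and
  \<open>arc\<close> leads back from the arc group.\<close>

theorem abelian_normal_pure_trivial:
  assumes complete: "\<And>u w. ev e u = ev e w \<Longrightarrow> ev (phi iv n) u = ev (phi iv n) w"
    and conj: "\<And>a g. a \<in> ev e ` vwords n \<Longrightarrow> g \<in> N \<Longrightarrow> a + g - a \<in> N"
    and comm: "\<And>g h. g \<in> N \<Longrightarrow> h \<in> N \<Longrightarrow> g + h = h + g"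
    and w: "w \<in> vwords n" "ev e w \<in> N" "pp (vp w) = id"
  shows "ev e w = 0"
proof -
  interpret A: coxeter_matrix "cmn n" "brn iv n" by (rule coxeter_matrix_arcs)
  have gn: "A.gn iv = xg iv n" by (simp add: A.gn_def xg_def)
  define M where "M = {ev (xg iv n) (aw id u) | u. u \<in> vwords n \<and> ev e u \<in> N \<and> pp (vp u) = id}"
  have id: "id permutes {1..n}" by (rule permutes_id)
  have "M \<subseteq> {0}"
  proof (rule A.abelian_normal_trivial[OF finite_arcs, where iv = iv, unfolded gn])
    show "\<exists>t. free_pair (cmn n) (brn iv n) (arcs n) s t" if "s \<in> arcs n" for s
      using free_pair_arcs[OF n3 that] .
    show "M \<subseteq> gspan (xg iv n) (arcs n)"
      unfolding M_def gspan_def using aw_lists[OF _ id] by blast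
  next
    fix a g assume "a \<in> gspan (xg iv n) (arcs n)" "g \<in> M"
    then obtain x u where x: "x \<in> lists (Sigma (arcs n) (\<lambda>_. UNIV))" "a = ev (xg iv n) x"
      and u: "u \<in> vwords n" "ev e u \<in> N" "pp (vp u) = id" "g = ev (xg iv n) (aw id u)"
      unfolding M_def gspan_def by blast
    have mid: "map (\<lambda>((i, j), b). ((id i, id j), b)) y = y" for y :: "(nat \<times> nat) word"
      by (induction y) auto
    obtain y z where y: "y \<in> vwords n" "pp (vp y) = id" "aw id y = x"
      and z: "z \<in> vwords n" "pp (vp z) = id" "aw id z = winv x"
      using lift_arc_word[OF x(1)] lift_arc_word[of "winv x"] x(1) unfolding winv_lists by (metis mid)
    have "ev e z = - ev e y" using rewrite_pure[OF y(1,2)] rewrite_pure[OF z(1,2)] y(3) z(3) by simp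
    then have "ev e (y @ u @ z) \<in> N" using conj[of "ev e y"] u(2) y(1) by (simp add: gsimps del: add_uminus_conv_diff)
    moreover have "y @ u @ z \<in> vwords n" "pp (vp (y @ u @ z)) = id"
      using y z u by (simp_all add: vp_append)
    moreover have "a + g - a = ev (xg iv n) (aw id (y @ u @ z))"
      using x y z u by (simp add: aw_append gsimps del: add_uminus_conv_diff)
    ultimately show "a + g - a \<in> M" unfolding M_def by blast
  next
    fix g h assume "g \<in> M" "h \<in> M"
    then obtain u x where u: "u \<in> vwords n" "ev e u \<in> N" "pp (vp u) = id" "g = ev (xg iv n) (aw id u)"
      and x: "x \<in> vwords n" "ev e x \<in> N" "pp (vp x) = id" "h = ev (xg iv n) (aw id x)"
      unfolding M_def by blast
    have "ev e (u @ x) = ev e (x @ u)" using comm u x by simp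
    then have "app (ev (phi iv n) (u @ x)) (0, id) = app (ev (phi iv n) (x @ u)) (0, id)"
      using complete by metis
    moreover have "u @ x \<in> vwords n" "x @ u \<in> vwords n" using u x by simp_all
    ultimately show "g + h = h + g"
      using u x by (simp add: phi_walk[OF _ id] aw_append vp_append del: ev_append)
        (simp add: aw_append)
  qed
  then have "ev (xg iv n) (aw id w) = ev (xg iv n) []" unfolding M_def using w by auto
  then have "ev arc (aw id w) = ev arc []" by (rule xg_universal[OF arc_ok])
  then show ?thesis using rewrite_pure[OF w(1,3)] by simp
qed

theorem abelian_normal_trivial:
  assumes iv
    and complete: "\<And>u w. ev e u = ev e w \<Longrightarrow> ev (phi iv n) u = ev (phi iv n) w"
    and N: "N \<subseteq> ev e ` vwords n" "\<And>g h. g \<in> N \<Longrightarrow> h \<in> N \<Longrightarrow> g + h \<in> N" "\<And>g. g \<in> N \<Longrightarrow> - g \<in> N"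
    and conj: "\<And>a g. a \<in> ev e ` vwords n \<Longrightarrow> g \<in> N \<Longrightarrow> a + g - a \<in> N"
    and comm: "\<And>g h. g \<in> N \<Longrightarrow> h \<in> N \<Longrightarrow> g + h = h + g"
  shows "N \<subseteq> {0}"
proof
  fix g assume g: "g \<in> N"
  then obtain w where w: "w \<in> vwords n" "g = ev e w" using N(1) by blast
  note pure = abelian_normal_pure_trivial[OF complete conj comm]
  define p where "p = pp (vp w)"
  have perm: "p permutes {1..n}" unfolding p_def using pp_permutes vp_set[OF w(1)] .
  have id: "id permutes {1..n}" by (rule permutes_id)
  have fixes_arc: "(p i, p j) = (i, j)" if ij: "(i, j) \<in> arcs n" for i j
  proof -
    obtain u where u: "u \<in> vwords n" "pp (vp u) = id" "\<And>q. aw q u = [((q i, q j), True)]"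
      using lift_arc_word[of "[((i, j), True)]"] ij by auto
    \<comment> \<open>The commutator of w with the pure lift u of an arc is pure and in N, hence
      0.\<close>
    let ?c = "w @ u @ winv w @ winv u"
    have "ev e u + - g - ev e u \<in> N" using g u(1) by (intro conj N(3)) auto
    from N(2)[OF g this] have cN: "ev e ?c \<in> N" by (simp add: w(2) gsimps del: add_uminus_conv_diff)
    have "pp (vp ?c) = p \<circ> pp (rev (vp w)) \<circ> (pp (vp u) \<circ> pp (rev (vp u)))"
      using u(2) by (simp add: vp_append vp_winv p_def comp_assoc)
    also have "\<dots> = id"
      using pp_rev[of "rev (vp w)"] pp_rev[of "rev (vp u)"] by (simp add: p_def)
    finally have "ev e ?c = 0" using w(1) u(1) cN by (intro pure) (simp_all del: in_lists_conv_set)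
    then have "ev e w + ev e u - ev e w - ev e u = 0" by (simp add: gsimps del: add_uminus_conv_diff)
    then have "ev e (w @ u) = ev e (u @ w)" by (simp add: diff_eq_eq)
    then have "app (ev (phi iv n) (w @ u)) (0, id) = app (ev (phi iv n) (u @ w)) (0, id)"
      using complete by metis
    moreover have "w @ u \<in> vwords n" "u @ w \<in> vwords n" using u(1) w(1) by simp_all
    ultimately have *: "ev (xg iv n) (aw id (w @ u)) = ev (xg iv n) (aw id (u @ w))"
      by (simp add: phi_walk[OF _ id] del: ev_append)
    \<comment> \<open>The arc (i, j) is counted modulo 2. This respects squares and commutations,
      and \<open>iv\<close> excludes braid relations; applied to both words it forces p to fix the
      arc.\<close>
    define f where "f = (\<lambda>q. if q = (i, j) then 1 else 0 :: bit)"
    have "arel_ok (cmn n) (brn iv n) iv f"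
      by (auto simp: arel_ok_def brn_def f_def \<open>iv\<close>)
    then have "ev f (aw id (w @ u)) = ev f (aw id (u @ w))" using * by (rule xg_universal)
    moreover have "aw id (w @ u) = aw id w @ [((p i, p j), True)]" "aw id (u @ w) = ((i, j), True) # aw id w"
      using u(2,3) by (simp_all add: aw_append p_def)
    ultimately have "ev f (aw id w) + f (p i, p j) = f (i, j) + ev f (aw id w)"
      by (simp only: ev_append ev_simps if_True add_0_right)
    then have "f (p i, p j) = f (i, j)" by (metis add.commute add_left_cancel)
    then show ?thesis by (simp add: f_def split: if_splits)
  qed
  have "p i = i" for i
  proof (cases "i \<in> {1..n}")
    case True
    then obtain j where "(i, j) \<in> arcs n"
      using n3 that[of 1] that[of 2] by (cases "i = 1") (auto simp: arcs_def)
    then show ?thesis using fixes_arc by blast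
  next
    case False
    then show ?thesis using perm by (rule permutes_not_in[rotated])
  qed
  then have "pp (vp w) = id" by (auto simp: p_def)
  then show "g \<in> {0}" using pure w g by simp
qed

end

subsection \<open>The presented groups\<close>

lemma presented_group_simps:
  "\<one>\<^bsub>presented_group S R\<^esub> = wclass R []"
  "wclass R u \<otimes>\<^bsub>presented_group S R\<^esub> wclass R w = wclass R (u @ w)"
  "A \<in> carrier (presented_group S R) \<longleftrightarrow> (\<exists>w\<in>lists (Sigma S (\<lambda>_. UNIV)). A = wclass R w)"
proof -
  have "wequiv R (u @ w) z \<longleftrightarrow> (\<exists>a. wequiv R u a \<and> (\<exists>b. wequiv R w b \<and> wequiv R (a @ b) z))" for z
    by (meson wequiv_append wrefl wsym wtrans)
  then show "wclass R u \<otimes>\<^bsub>presented_group S R\<^esub> wclass R w = wclass R (u @ w)"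
    by (auto simp: presented_group_def wclass_def)
qed (auto simp: presented_group_def)

text \<open>Carries a normal subgroup consisting of classes over to a set of permutations, where
  words are evaluated by \<open>ev\<close>.\<close>

lemma normal_subgroup_values:
  fixes R :: "'a word set" and S :: "'a set"
  defines "L \<equiv> lists (Sigma S (\<lambda>_. UNIV))"
  assumes "H \<lhd> presented_group S R"
  defines "N \<equiv> {ev (canon R) w | w. w \<in> L \<and> wclass R w \<in> H}"
  shows "w \<in> L \<Longrightarrow> ev (canon R) w \<in> N \<longleftrightarrow> wclass R w \<in> H"
    and "g \<in> N \<Longrightarrow> h \<in> N \<Longrightarrow> g + h \<in> N"
    and "g \<in> N \<Longrightarrow> - g \<in> N"
    and "a \<in> ev (canon R) ` L \<Longrightarrow> g \<in> N \<Longrightarrow> a + g - a \<in> N"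
    and "(\<And>x y. x \<in> H \<Longrightarrow> y \<in> H \<Longrightarrow> x \<otimes>\<^bsub>presented_group S R\<^esub> y = y \<otimes>\<^bsub>presented_group S R\<^esub> x)
      \<Longrightarrow> g \<in> N \<Longrightarrow> h \<in> N \<Longrightarrow> g + h = h + g"
    and "N \<subseteq> {0} \<Longrightarrow> H = {\<one>\<^bsub>presented_group S R\<^esub>}"
proof -
  interpret normal H "presented_group S R" by fact
  have L: "[] \<in> L" "u @ w \<in> L \<longleftrightarrow> u \<in> L \<and> w \<in> L" "winv w \<in> L \<longleftrightarrow> w \<in> L" for u w
    unfolding L_def by (simp, rule append_in_lists_conv, rule winv_lists)
  have car: "A \<in> carrier (presented_group S R) \<longleftrightarrow> (\<exists>w\<in>L. A = wclass R w)" for A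
    unfolding L_def by (rule presented_group_simps(3))
  have inv: "inv\<^bsub>presented_group S R\<^esub> wclass R w = wclass R (winv w)" if "w \<in> L" for w
  proof (rule inv_equality)
    show "wclass R w \<in> carrier (presented_group S R)" "wclass R (winv w) \<in> carrier (presented_group S R)"
      using that L(3)[of w] car by blast+
  qed (simp add: presented_group_simps(1,2) wclass_eq_iff wequiv_winv)
  show mem: "ev (canon R) w \<in> N \<longleftrightarrow> wclass R w \<in> H" if "w \<in> L" for w
    using that unfolding N_def by (auto simp: ev_canon_eq_iff simp flip: wclass_eq_iff)
  have NE: "\<exists>w\<in>L. g = ev (canon R) w \<and> wclass R w \<in> H" if "g \<in> N" for g
    using that unfolding N_def by blast
  show "g + h \<in> N" if gh: "g \<in> N" "h \<in> N" for g h
  proof -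
    obtain u w where u: "u \<in> L" "g = ev (canon R) u" "wclass R u \<in> H"
      and w: "w \<in> L" "h = ev (canon R) w" "wclass R w \<in> H" using NE gh by meson
    then show ?thesis using mem[of "u @ w"] subgroup.m_closed[OF is_subgroup u(3) w(3)] L(2) by (simp add: presented_group_simps)
  qed
  show "- g \<in> N" if g: "g \<in> N" for g
  proof -
    obtain u where u: "u \<in> L" "g = ev (canon R) u" "wclass R u \<in> H" using NE g by meson
    then show ?thesis using mem[of "winv u"] subgroup.m_inv_closed[OF is_subgroup u(3)] inv[OF u(1)] L(3) by simp
  qed
  show "a + g - a \<in> N" if ag: "a \<in> ev (canon R) ` L" "g \<in> N" for a g
  proof -
    obtain u where u: "u \<in> L" "g = ev (canon R) u" "wclass R u \<in> H" using NE ag(2) by meson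
    obtain w where w: "w \<in> L" "a = ev (canon R) w" using ag(1) by blast
    have "wclass R w \<in> carrier (presented_group S R)" using w(1) car by blast
    from inv_op_closed2[OF this u(3)] have "wclass R ((w @ u) @ winv w) \<in> H"
      by (simp only: inv[OF w(1)] presented_group_simps)
    then show ?thesis using mem[of "(w @ u) @ winv w"] L u w by (simp add: add_diff_eq)
  qed
  show "g + h = h + g"
    if comm: "\<And>x y. x \<in> H \<Longrightarrow> y \<in> H \<Longrightarrow> x \<otimes>\<^bsub>presented_group S R\<^esub> y = y \<otimes>\<^bsub>presented_group S R\<^esub> x"
      and gh: "g \<in> N" "h \<in> N" for g h
  proof -
    obtain u w where u: "u \<in> L" "g = ev (canon R) u" "wclass R u \<in> H"
      and w: "w \<in> L" "h = ev (canon R) w" "wclass R w \<in> H" using NE gh by meson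
    have "wequiv R (u @ w) (w @ u)"
      using comm[OF u(3) w(3)] by (simp add: presented_group_simps wclass_eq_iff)
    then show ?thesis using u w by (simp flip: ev_canon_eq_iff)
  qed
  show "H = {\<one>\<^bsub>presented_group S R\<^esub>}" if "N \<subseteq> {0}"
  proof -
    have "A = \<one>\<^bsub>presented_group S R\<^esub>" if A: "A \<in> H" for A
    proof -
      obtain w where w: "w \<in> L" "A = wclass R w" using car subgroup.mem_carrier[OF is_subgroup A] by blast
      then have "ev (canon R) w \<in> N" using mem A by simp
      then have "ev (canon R) w = ev (canon R) []" using \<open>N \<subseteq> {0}\<close> by auto
      then show ?thesis by (simp only: w(2) presented_group_simps wclass_eq_iff ev_canon_eq_iff)
    qed
    then show ?thesis using subgroup.one_closed[OF is_subgroup] by blast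
  qed
qed

lemma ball_setcompr:
  "(\<forall>r\<in>{h i | i. Q i}. P r) \<longleftrightarrow> (\<forall>i. Q i \<longrightarrow> P (h i))"
  "(\<forall>r\<in>{k i j | i j. Q' i j}. P r) \<longleftrightarrow> (\<forall>i j. Q' i j \<longrightarrow> P (k i j))"
  by blast+

lemma virtual_rels_VB:
  assumes "n \<ge> 3"
  shows "virtual_rels n False f \<longleftrightarrow> (\<forall>r\<in>VB_rels n. ev f r = 0)"
  unfolding virtual_rels_def VB_rels_def ball_Un ball_setcompr
  by (simp only: ev_relator list.map sum_list.Nil sum_list.Cons right_minus_eq add_0_right assms
      simp_thms imp_conjL)
    (rule iffI; intro conjI; elim conjE; assumption)

fun vt_of_vb :: "vbgen \<Rightarrow> vtgen" where
  "vt_of_vb (Sig i) = Tw i"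
| "vt_of_vb (Vg i) = Rho i"

fun vb_of_vt :: "vtgen \<Rightarrow> vbgen" where
  "vb_of_vt (Tw i) = Sig i"
| "vb_of_vt (Rho i) = Vg i"

lemma vt_vb [simp]: "vt_of_vb (vb_of_vt g) = g" "vb_of_vt (vt_of_vb h) = h"
  by (cases g; simp) (cases h; simp)

lemma vb_of_vt_gens [simp]: "vb_of_vt g \<in> VB_gens n \<longleftrightarrow> g \<in> VT_gens n"
  by (cases g) (auto simp: VT_gens_def VB_gens_def)

lemma virtual_rels_VT:
  assumes "n \<ge> 3"
  shows "virtual_rels n True (f \<circ> vt_of_vb) \<longleftrightarrow> (\<forall>r\<in>VT_rels n. ev f r = 0)"
proof -
  have far_sym: "far i j \<Longrightarrow> far j i" for i j by (auto simp: far_def)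
  \<comment> \<open>The mixed far commutations are listed with the two kinds of letters in opposite
    order; exchanging i and j matches them.\<close>
  have swap: "(\<forall>i j. 1 \<le> i \<and> i \<le> n - 1 \<and> 1 \<le> j \<and> j \<le> n - 1 \<and> far i j \<longrightarrow> f (Rho i) + f (Tw j) = f (Tw j) + f (Rho i))
    \<longleftrightarrow> (\<forall>i j. 1 \<le> i \<and> i \<le> n - 1 \<and> 1 \<le> j \<and> j \<le> n - 1 \<and> far i j \<longrightarrow> f (Tw i) + f (Rho j) = f (Rho j) + f (Tw i))"
    (is "(\<forall>i j. ?I i j \<longrightarrow> ?l i j) \<longleftrightarrow> (\<forall>i j. ?I i j \<longrightarrow> ?r i j)")
  proof -
    have "?I i j \<Longrightarrow> ?I j i" for i j using far_sym by blast
    moreover have "?l i j \<longleftrightarrow> ?r j i" for i j by (rule eq_commute)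
    ultimately show ?thesis by blast
  qed
  show ?thesis
    unfolding virtual_rels_def VT_rels_def ball_Un ball_setcompr comp_apply vt_of_vb.simps
    by (simp only: ev_relator list.map sum_list.Nil sum_list.Cons right_minus_eq add_0_right assms swap,
        simp only: simp_thms imp_conjL)
      (rule iffI; intro conjI; elim conjE; assumption)
qed

lemma ev_map: "ev f (map (apfst h) w) = ev (f \<circ> h) w"
  by (induction w) auto

lemma VB_abelian_normal:
  assumes "n \<ge> 3" "H \<lhd> VB n" "H \<subseteq> KB n"
    and comm: "\<And>x y. x \<in> H \<Longrightarrow> y \<in> H \<Longrightarrow> x \<otimes>\<^bsub>VB n\<^esub> y = y \<otimes>\<^bsub>VB n\<^esub> x"
  shows "H = {\<one>\<^bsub>VB n\<^esub>}"
proof -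
  define e where "e = canon (VB_rels n)"
  interpret virtual_rels n False e
    using virtual_rels_VB[OF assms(1), of e] canon_rel by (auto simp: e_def)
  have complete: "ev e u = ev e w \<Longrightarrow> ev (phi False n) u = ev (phi False n) w" for u w
    unfolding e_def
    by (rule ev_canon_universal) (use virtual_rels_VB[OF assms(1)] phi_virtual_rels[OF assms(1)] in auto)
  note vals = normal_subgroup_values[OF assms(2)[unfolded VB_def], folded e_def]
  let ?N = "{ev e w | w. w \<in> vwords n \<and> wclass (VB_rels n) w \<in> H}"
  have "ev e w = 0" if w: "w \<in> vwords n" "wclass (VB_rels n) w \<in> H" for w
  proof -
    \<comment> \<open>The kernel supplies only some equivalent word v; the action \<open>phi\<close>
      gives w the same permutation.\<close>
    obtain v where v: "wequiv (VB_rels n) w v" "weval piK_gen v = id"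
      using w(2) assms(3) unfolding KB_def pkernel_def wclass_def by blast
    have "ev (phi False n) w = ev (phi False n) v"
      using v(1) by (intro complete) (simp add: e_def ev_canon_eq_iff)
    then have "pp (vp w) = id"
      using phi_perm[of False n w 0 id] phi_perm[of False n v 0 id] v(2) by (simp add: weval_piK)
    moreover have "ev e w \<in> ?N" using w by blast
    ultimately show ?thesis
      using abelian_normal_pure_trivial[OF complete vals(4) vals(5)[OF comm[unfolded VB_def]], of w] w(1)
      by blast
  qed
  then have "?N \<subseteq> {0}" by blast
  then show ?thesis unfolding VB_def by (rule vals(6))
qed

text \<open>Serves both kernels in the twin group at once.\<close>

lemma VT_abelian_normal:
  assumes "n \<ge> 3" "H \<lhd> VT n"
    and comm: "\<And>x y. x \<in> H \<Longrightarrow> y \<in> H \<Longrightarrow> x \<otimes>\<^bsub>VT n\<^esub> y = y \<otimes>\<^bsub>VT n\<^esub> x"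
  shows "H = {\<one>\<^bsub>VT n\<^esub>}"
proof -
  define c where "c = canon (VT_rels n)"
  define e where "e = c \<circ> vt_of_vb"
  interpret virtual_rels n True e
    unfolding e_def using virtual_rels_VT[OF assms(1), of c] canon_rel by (auto simp: c_def)
  have phi_c: "\<forall>r\<in>VT_rels n. ev (phi True n \<circ> vb_of_vt) r = 0"
    using virtual_rels_VT[OF assms(1), of "phi True n \<circ> vb_of_vt"] phi_virtual_rels[OF assms(1), of True]
    by (simp add: comp_def)
  have complete: "ev (phi True n) u = ev (phi True n) w" if "ev e u = ev e w" for u w
  proof -
    have "ev c (map (apfst vt_of_vb) u) = ev c (map (apfst vt_of_vb) w)" using that by (simp add: ev_map e_def)
    then have "ev (phi True n \<circ> vb_of_vt) (map (apfst vt_of_vb) u) = ev (phi True n \<circ> vb_of_vt) (map (apfst vt_of_vb) w)"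
      unfolding c_def by (rule ev_canon_universal[rotated]) (use phi_c in blast)
    then show ?thesis by (simp add: ev_map comp_def)
  qed
  note vals = normal_subgroup_values[OF assms(2)[unfolded VT_def], folded c_def]
  let ?L = "lists (Sigma (VT_gens n) (\<lambda>_. UNIV))"
  have L: "ev e ` vwords n = ev c ` ?L"
  proof
    show "ev e ` vwords n \<subseteq> ev c ` ?L"
    proof
      fix g assume "g \<in> ev e ` vwords n"
      then obtain w where w: "w \<in> vwords n" "g = ev e w" by blast
      have "map (apfst vt_of_vb) w \<in> ?L" using w(1) by (induction w) (auto simp flip: vb_of_vt_gens)
      then show "g \<in> ev c ` ?L" using w(2) by (auto simp: e_def simp flip: ev_map)
    qed
    show "ev c ` ?L \<subseteq> ev e ` vwords n"
    proof
      fix g assume "g \<in> ev c ` ?L"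
      then obtain w where w: "w \<in> ?L" "g = ev c w" by blast
      have "map (apfst vb_of_vt) w \<in> vwords n" using w(1) by (induction w) auto
      moreover have "g = ev e (map (apfst vb_of_vt) w)" by (simp add: ev_map w(2) e_def comp_def)
      ultimately show "g \<in> ev e ` vwords n" by blast
    qed
  qed
  let ?N = "{ev c w | w. w \<in> ?L \<and> wclass (VT_rels n) w \<in> H}"
  have "?N \<subseteq> {0}"
  proof (rule abelian_normal_trivial[OF TrueI complete])
    show "?N \<subseteq> ev e ` vwords n" unfolding L by blast
  qed (use vals(2,3,4) vals(5)[OF comm[unfolded VT_def]] in \<open>auto simp only: L\<close>)
  then show ?thesis unfolding VT_def by (rule vals(6))
qed

theorem theorem5p17:
  fixes n :: nat
  assumes "n \<ge> 3"
  shows "(\<forall>H. abelian_normal_in (VB n) (KB n) H \<longrightarrow> H = {\<one>\<^bsub>VB n\<^esub>})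
       \<and> (\<forall>H. abelian_normal_in (VT n) (PVT n) H \<longrightarrow> H = {\<one>\<^bsub>VT n\<^esub>})
       \<and> (\<forall>H. abelian_normal_in (VT n) (KT n) H \<longrightarrow> H = {\<one>\<^bsub>VT n\<^esub>})"
  using VB_abelian_normal[OF assms] VT_abelian_normal[OF assms]
  unfolding abelian_normal_in_def by simp

end
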